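(* Let $0<p<\infty$ and let $\varphi:\mathbb H\to\mathbb H$ be holomorphic. The composition operator $C_\varphi$ is bounded on $H^p(\mathbb H)$ if and only if it is bounded on $H^2(\mathbb H)$, in which case $\|C_\varphi\|_{H^p}=\lambda^{1/p}$, where $\lambda=\varphi'(\infty)$ is the angular derivative of $\varphi$ at infinity.
   Context: $\mathbb H=\{z\in\mathbb C:\Re z>0\}$ is the open right half-plane. For $0<p<\infty$, $H^p(\mathbb H)$ is the space of holomorphic functions $f$ on $\mathbb H$ with $\sup_{x>0}\frac{1}{2\pi}\int_{-\infty}^{\infty}|f(x+iy)|^p\,dy<\infty$, and $\|f\|_{H^p}$ denotes the $p$-th root of this supremum (a norm if $p\ge 1$, a quasi-norm if $0<p<1$). For a holomorphic map $\varphi:\mathbb H\to\mathbb H$, the composition operator is $C_\varphi f=f\circ\varphi$; it is bounded on $H^p(\mathbb H)$ if it maps $H^p(\mathbb H)$ into itself and $\|C_\varphi\|_{H^p}:=\sup\{\|f\circ\varphi\|_{H^p}:\|f\|_{H^p}\le 1\}$ is finite. A sequence $z_n=x_n+iy_n$ in $\mathbb H$ approaches $\infty$ non-tangentially if $x_n\to\infty$ and the ratios $|y_n|/x_n$ are uniformly bounded. The map $\varphi$ fixes infinity non-tangentially, written $\varphi(\infty)=\infty$, if $\varphi(z_n)\to\infty$ whenever $z_n\to\infty$ non-tangentially. If $\varphi(\infty)=\infty$, then $\varphi$ has a finite angular derivative at $\infty$ if the non-tangential limit $\lim_{z\to\infty}\frac{z}{\varphi(z)}$ exists and is finite (i.e.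 the limit exists, with the same value, along every sequence in $\mathbb H$ approaching $\infty$ non-tangentially); this limit is denoted $\varphi'(\infty)$. Part of the conclusion is that, when $C_\varphi$ is bounded, $\varphi(\infty)=\infty$ and $\varphi'(\infty)$ exists and is finite. *)

theory Defs
  imports "HOL-Analysis.Analysis"
begin

definition right_half_plane :: "complex set" where
  "right_half_plane = {z. Re z > 0}"

definition hardy_sup :: "real \<Rightarrow> (complex \<Rightarrow> complex) \<Rightarrow> ennreal" where
  "hardy_sup p f =
     (SUP x\<in>{0<..}. ennreal (1 / (2 * pi)) * (\<integral>\<^sup>+ y. ennreal (norm (f (Complex x y)) powr p) \<partial>lborel))"

text \<open>Elements of the Hardy space are total functions; their values outside the half-plane are
  irrelevant.\<close>

definition hardy_space :: "real \<Rightarrow> (complex \<Rightarrow> complex) set" where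
  "hardy_space p = {f. f holomorphic_on right_half_plane \<and> hardy_sup p f < \<infinity>}"

text \<open>Meaningful only on \<open>hardy_space p\<close>: elsewhere the supremum may be infinite, and
  \<open>enn2real\<close> then returns 0.\<close>

definition hardy_norm :: "real \<Rightarrow> (complex \<Rightarrow> complex) \<Rightarrow> real" where
  "hardy_norm p f = enn2real (hardy_sup p f) powr (1 / p)"

definition hardy_unit_ball :: "real \<Rightarrow> (complex \<Rightarrow> complex) set" where
  "hardy_unit_ball p = {f \<in> hardy_space p. hardy_norm p f \<le> 1}"

definition comp_op_bounded :: "real \<Rightarrow> (complex \<Rightarrow> complex) \<Rightarrow> bool" where
  "comp_op_bounded p \<phi> \<longleftrightarrow>
     (\<forall>f\<in>hardy_space p. f \<circ> \<phi> \<in> hardy_space p) \<and>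
     bdd_above ((\<lambda>f. hardy_norm p (f \<circ> \<phi>)) ` hardy_unit_ball p)"

text \<open>Meaningful only when \<open>comp_op_bounded p \<phi>\<close> holds.\<close>

definition comp_op_norm :: "real \<Rightarrow> (complex \<Rightarrow> complex) \<Rightarrow> real" where
  "comp_op_norm p \<phi> = (SUP f\<in>hardy_unit_ball p. hardy_norm p (f \<circ> \<phi>))"

definition nontangential_to_infinity :: "(nat \<Rightarrow> complex) \<Rightarrow> bool" where
  "nontangential_to_infinity z \<longleftrightarrow>
     (\<forall>n. z n \<in> right_half_plane) \<and>
     filterlim (\<lambda>n. Re (z n)) at_top sequentially \<and>
     (\<exists>M. \<forall>n. \<bar>Im (z n)\<bar> / Re (z n) \<le> M)"

text \<open>Convergence of the image sequence is to the point at infinity of the Riemann sphere; it need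
  not be non-tangential.\<close>

definition fixes_infinity :: "(complex \<Rightarrow> complex) \<Rightarrow> bool" where
  "fixes_infinity \<phi> \<longleftrightarrow>
     (\<forall>z. nontangential_to_infinity z \<longrightarrow> filterlim (\<lambda>n. \<phi> (z n)) at_infinity sequentially)"

definition has_angular_deriv_at_infinity :: "(complex \<Rightarrow> complex) \<Rightarrow> complex \<Rightarrow> bool" where
  "has_angular_deriv_at_infinity \<phi> L \<longleftrightarrow>
     fixes_infinity \<phi> \<and>
     (\<forall>z. nontangential_to_infinity z \<longrightarrow> (\<lambda>n. z n / \<phi> (z n)) \<longlonglongrightarrow> L)"

lemma nontangential_to_infinity_Suc: "nontangential_to_infinity (\<lambda>n. of_nat (Suc n))"
proof -
  have "filterlim (\<lambda>n. real (Suc n)) at_top sequentially"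
    by (rule filterlim_compose[OF filterlim_real_sequentially filterlim_Suc])
  then show ?thesis
    unfolding nontangential_to_infinity_def right_half_plane_def
    by (auto intro: exI[of _ 0])
qed

lemma has_angular_deriv_at_infinity_unique:
  assumes "has_angular_deriv_at_infinity \<phi> L" and "has_angular_deriv_at_infinity \<phi> L'"
  shows "L = L'"
  using assms nontangential_to_infinity_Suc LIMSEQ_unique
  unfolding has_angular_deriv_at_infinity_def by blast

end

theory Submission
  imports Defs "HOL-Complex_Analysis.Complex_Analysis"
begin

text \<open>Let \<open>c\<close> be the infimum of \<open>Re (\<phi> z) / Re z\<close>. By the Julia--Caratheodory theorem the angular derivative
  at infinity is \<open>1 / c\<close>, so it suffices to show that \<open>C\<^sub>\<phi>\<close> is bounded on \<open>H\<^sup>p\<close> exactly when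
  \<open>c > 0\<close>, with the \<open>p\<close>-th power of the norm equal to \<open>1 / c\<close>.

  Upper bound: \<open>\<bar>f\<bar>\<^sup>p\<close> is dominated by the Poisson integral of its values on a vertical line. Compose this
  with \<open>\<phi>\<close> and integrate. For fixed \<open>t\<close>, the kernel \<open>poisson_kernel (\<phi> z) t\<close> is the positive harmonic
  function \<open>Re (1 / (\<phi> z - \<i> t)) / \<pi>\<close>, and its integral over a vertical line is controlled by its decay
  at infinity: it is at most \<open>1 / c\<close>.

  Lower bound: point evaluation at \<open>w\<close> satisfies the sharp estimate \<open>2 (Re w) \<bar>f w\<bar>\<^sup>p \<le> \<parallel>f\<parallel>\<^sup>p\<close>. Apply it to
  \<open>k \<circ> \<phi>\<close>, where \<open>k\<close> is the extremal function of the same estimate at \<open>\<phi> w\<close>.\<close>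

section \<open>Circle means of powers of holomorphic functions\<close>

lemma continuous_on_circle_param:
  assumes "f holomorphic_on ball 0 R" "0 \<le> s" "s < R"
  shows "continuous_on A (\<lambda>\<theta>. f (of_real s * cis (2 * pi * \<theta>)))"
  using assms
  by (intro continuous_on_compose2[OF holomorphic_on_imp_continuous_on[OF assms(1)]])
     (auto intro!: continuous_intros simp: norm_mult)

text \<open>The weight is the Cauchy kernel in the angular parameter: on the circle, dz is
  \<open>2 * pi * \<i> * z\<close> times d\<theta>. At \<open>w = 0\<close> it equals 1 and the mean
  value property remains.\<close>

lemma Cauchy_integral_circle:
  assumes "f holomorphic_on ball 0 R" "norm w < s" "s < R"
  shows "((\<lambda>\<theta>. f (of_real s * cis (2 * pi * \<theta>)) *
           (of_real s * cis (2 * pi * \<theta>) / (of_real s * cis (2 * pi * \<theta>) - w))) has_integral f w) {0..1}"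
proof -
  have "f holomorphic_on cball 0 s"
    using assms by (auto intro!: holomorphic_on_subset[OF assms(1)])
  then have "((\<lambda>u. f u / (u - w)) has_contour_integral (2 * of_real pi * \<i> * f w)) (circlepath 0 s)"
    using assms by (intro Cauchy_integral_circlepath_simple) auto
  then have "((\<lambda>x. f (of_real s * cis (2 * pi * x)) *
      (of_real s * cis (2 * pi * x) / (of_real s * cis (2 * pi * x) - w)) * (2 * of_real pi * \<i>))
      has_integral (f w * (2 * of_real pi * \<i>))) {0..1}"
    unfolding has_contour_integral vector_derivative_circlepath
    by (simp add: circlepath cis_conv_exp mult_ac)
  from has_integral_divide[OF this, of "2 * of_real pi * \<i>"]
  show ?thesis by simp
qed

text \<open>The Cauchy weight has modulus at most \<open>s / (s - norm w)\<close>. This equals 1 at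
  the centre, where the sharp estimates use it; off the centre only its boundedness matters.\<close>

lemma norm_le_circle_mean:
  fixes f :: "complex \<Rightarrow> complex"
  assumes "f holomorphic_on ball 0 R" "norm w < s" "s < R"
  shows "norm (f w) \<le> s / (s - norm w) * integral {0..1} (\<lambda>\<theta>. norm (f (of_real s * cis (2 * pi * \<theta>))))"
proof -
  have s: "0 < s" using assms(2) norm_ge_zero[of w] by linarith
  let ?c = "\<lambda>\<theta>. of_real s * cis (2 * pi * \<theta>)"
  have I: "((\<lambda>\<theta>. f (?c \<theta>) * (?c \<theta> / (?c \<theta> - w))) has_integral f w) {0..1}"
    by (rule Cauchy_integral_circle[OF assms])
  have int: "(\<lambda>\<theta>. norm (f (?c \<theta>))) integrable_on {0..1}"
    using assms s
    by (intro integrable_continuous_interval continuous_on_norm continuous_on_circle_param) auto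
  have "norm (integral {0..1} (\<lambda>\<theta>. f (?c \<theta>) * (?c \<theta> / (?c \<theta> - w))))
      \<le> integral {0..1} (\<lambda>\<theta>. s / (s - norm w) * norm (f (?c \<theta>)))"
  proof (rule integral_norm_bound_integral)
    show "(\<lambda>\<theta>. f (?c \<theta>) * (?c \<theta> / (?c \<theta> - w))) integrable_on {0..1}"
      using I by blast
    show "(\<lambda>\<theta>. s / (s - norm w) * norm (f (?c \<theta>))) integrable_on {0..1}"
      using int by (rule integrable_on_mult_right)
    fix \<theta> :: real
    have "s - norm w \<le> norm (?c \<theta> - w)"
      using norm_triangle_ineq2[of "?c \<theta>" w] s by (simp add: norm_mult)
    then have "s / norm (?c \<theta> - w) \<le> s / (s - norm w)"
      using s assms(2) by (intro divide_left_mono mult_pos_pos) auto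
    then have "norm (f (?c \<theta>)) * (s / norm (?c \<theta> - w)) \<le> norm (f (?c \<theta>)) * (s / (s - norm w))"
      by (rule mult_left_mono) simp
    then show "norm (f (?c \<theta>) * (?c \<theta> / (?c \<theta> - w))) \<le> s / (s - norm w) * norm (f (?c \<theta>))"
      using s by (simp add: norm_mult norm_divide mult_ac)
  qed
  then show ?thesis
    using integral_unique[OF I] by simp
qed

text \<open>A zero-free \<open>f\<close> has a logarithm \<open>g\<close> on the open disc, so
  \<open>norm (f z) powr p\<close> is there the modulus of the holomorphic
  \<open>exp (p * g z)\<close>. On the circle itself \<open>f\<close> may vanish, so the estimate is
  made on smaller circles and passes to radius \<open>r\<close> by continuity of the means.\<close>

lemma norm_powr_le_circle_mean_nonvanishing:
  fixes f :: "complex \<Rightarrow> complex"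
  assumes f: "f holomorphic_on ball 0 R" and r: "norm w < r" "r < R" and p: "0 < p"
    and nz: "\<And>z. norm z < r \<Longrightarrow> f z \<noteq> 0"
  shows "norm (f w) powr p \<le>
    r / (r - norm w) * integral {0..1} (\<lambda>\<theta>. norm (f (of_real r * cis (2 * pi * \<theta>))) powr p)"
proof -
  have r0: "0 < r" using r(1) norm_ge_zero[of w] by linarith
  have f': "f holomorphic_on ball 0 r"
    using r by (auto intro!: holomorphic_on_subset[OF f])
  obtain g where g: "g holomorphic_on ball 0 r" and gf: "\<And>z. z \<in> ball 0 r \<Longrightarrow> exp (g z) = f z"
    using holomorphic_logarithm_exists[OF convex_ball open_ball f', of 0] nz r0 by auto
  define G where "G z = exp (of_real p * g z)" for z
  have G: "G holomorphic_on ball 0 r"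
    unfolding G_def by (intro holomorphic_intros g)
  have nG: "norm (G z) = norm (f z) powr p" if "norm z < r" for z
  proof -
    have "norm (f z) = exp (Re (g z))"
      using gf[of z] that by (metis dist_0_norm mem_ball norm_exp_eq_Re)
    then show ?thesis by (simp add: G_def exp_powr_real mult.commute)
  qed
  define J where "J s = integral {0..1} (\<lambda>\<theta>. norm (f (of_real s * cis (2 * pi * \<theta>))) powr p)" for s :: real
  have contJ: "continuous_on {0..r} J"
    unfolding J_def
  proof -
    have "continuous_on ({0..r} \<times> cbox 0 1) (\<lambda>x. f (of_real (fst x) * cis (2 * pi * snd x)))"
      using r
      by (intro continuous_on_compose2[OF holomorphic_on_imp_continuous_on[OF f]])
         (auto intro!: continuous_intros simp: norm_mult)
    then have "continuous_on ({0..r} \<times> cbox 0 1) (\<lambda>x. norm (f (of_real (fst x) * cis (2 * pi * snd x))) powr p)"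
      using p by (intro continuous_on_powr') (auto intro!: continuous_intros)
    then have "continuous_on ({0..r} \<times> cbox 0 1) (\<lambda>(s, \<theta>). norm (f (of_real s * cis (2 * pi * \<theta>))) powr p)"
      by (simp add: case_prod_unfold)
    from integral_continuous_on_param[OF this]
    show "continuous_on {0..r} (\<lambda>s. integral {0..1} (\<lambda>\<theta>. norm (f (of_real s * cis (2 * pi * \<theta>))) powr p))"
      by simp
  qed
  have ev: "norm (f w) powr p \<le> s / (s - norm w) * J s" if "norm w < s" "s < r" for s
  proof -
    have s0: "0 < s" using that(1) norm_ge_zero[of w] by linarith
    have "norm (G w) \<le> s / (s - norm w) * integral {0..1} (\<lambda>\<theta>. norm (G (of_real s * cis (2 * pi * \<theta>))))"
      by (rule norm_le_circle_mean[OF G that])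
    also have "(\<lambda>\<theta>. norm (G (of_real s * cis (2 * pi * \<theta>)))) = (\<lambda>\<theta>. norm (f (of_real s * cis (2 * pi * \<theta>))) powr p)"
      using s0 that by (intro ext nG) (simp add: norm_mult)
    finally show ?thesis using nG[OF r(1)] by (simp add: J_def)
  qed
  have "(J \<longlongrightarrow> J r) (at r within {0..r})"
    using contJ r0 unfolding continuous_on_def by auto
  then have J: "(J \<longlongrightarrow> J r) (at_left r)"
    using r0 by (simp add: at_within_Icc_at_left)
  have "((\<lambda>s. s / (s - norm w) * J s) \<longlongrightarrow> r / (r - norm w) * J r) (at_left r)"
    using r by (intro tendsto_intros J) auto
  moreover have "\<forall>\<^sub>F s in at_left r. norm (f w) powr p \<le> s / (s - norm w) * J s"
    using eventually_at_left_real[OF r(1)] by eventually_elim (rule ev, auto)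
  ultimately show ?thesis
    unfolding J_def[symmetric]
    by (intro tendsto_lowerbound[OF _ _ trivial_limit_at_left_real])
qed

section \<open>Blaschke factors of a disc\<close>

lemma norm_Blaschke_denominator_le:
  fixes a z :: complex
  assumes "norm a \<le> r" "norm z \<le> r" "0 < r"
  shows "norm (z - a) \<le> norm ((of_real (r\<^sup>2) - cnj a * z) / of_real r)"
proof -
  \<comment> \<open>The difference of squares factors into two terms that are nonnegative in the
    closed disc; this is why a Blaschke factor has modulus at most 1.\<close>
  have id: "(norm (of_real (r\<^sup>2) - cnj a * z))\<^sup>2 - (r * norm (z - a))\<^sup>2
      = (r\<^sup>2 - (norm a)\<^sup>2) * (r\<^sup>2 - (norm z)\<^sup>2)"
    unfolding power_mult_distrib cmod_power2
    by (simp add: algebra_simps power2_eq_square)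
  have "(norm a)\<^sup>2 \<le> r\<^sup>2" "(norm z)\<^sup>2 \<le> r\<^sup>2"
    using assms by (auto intro!: power_mono)
  then have "(r * norm (z - a))\<^sup>2 \<le> (norm (of_real (r\<^sup>2) - cnj a * z))\<^sup>2"
    using mult_nonneg_nonneg[of "r\<^sup>2 - (norm a)\<^sup>2" "r\<^sup>2 - (norm z)\<^sup>2"] id by linarith
  then have "r * norm (z - a) \<le> norm (of_real (r\<^sup>2) - cnj a * z)"
    by (rule power2_le_imp_le) simp
  then show ?thesis
    using assms by (simp add: norm_divide field_simps)
qed

text \<open>On the circle \<open>r^2 = z * cnj z\<close>, which turns the numerator into
  \<open>z * cnj (z - a)\<close>.\<close>

lemma norm_Blaschke_denominator_circle:
  fixes a z :: complex
  assumes "norm z = r" "0 < r"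
  shows "norm ((of_real (r\<^sup>2) - cnj a * z) / of_real r) = norm (z - a)"
proof -
  have "of_real (r\<^sup>2) = z * cnj z"
    using assms(1) complex_norm_square[of z] by simp
  then have "of_real (r\<^sup>2) - cnj a * z = z * cnj (z - a)"
    by (simp add: algebra_simps)
  then show ?thesis using assms by (simp add: norm_divide norm_mult del: complex_cnj_diff)
qed

text \<open>The factor \<open>(z - a)^n\<close> of full multiplicity is replaced by the
  \<open>n\<close>-th power of \<open>(r^2 - cnj a * z) / r\<close>, which has no zero in the open
  disc. So \<open>a\<close> leaves the zero set altogether and the number of distinct zeros drops by
  one.\<close>

lemma remove_zero_Blaschke:
  fixes f :: "complex \<Rightarrow> complex"
  assumes f: "f holomorphic_on ball 0 R" "\<not> f constant_on ball 0 R"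
    and r: "0 < r" "r < R" and a: "norm a < r" "f a = 0"
  obtains g where "g holomorphic_on ball 0 R"
    "\<And>z. norm z < r \<Longrightarrow> g z = 0 \<longleftrightarrow> f z = 0 \<and> z \<noteq> a"
    "\<And>z. norm z < r \<Longrightarrow> norm (f z) \<le> norm (g z)"
    "\<And>z. norm z = r \<Longrightarrow> norm (g z) = norm (f z)"
proof -
  have aR: "a \<in> ball 0 R" using a r by simp
  obtain h \<rho> n where n: "0 < n" "0 < \<rho>" "ball a \<rho> \<subseteq> ball 0 R"
      and h: "h holomorphic_on ball a \<rho>" "\<And>w. w \<in> ball a \<rho> \<Longrightarrow> f w = (w - a)^n * h w"
      "\<And>w. w \<in> ball a \<rho> \<Longrightarrow> h w \<noteq> 0"
    using holomorphic_factor_zero_nonconstant[OF f(1) open_ball connected_ball aR a(2) f(2)] by metis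
  define k where "k z = (if z = a then h a else f z / (z - a)^n)" for z
  have kh: "k z = h z" if "z \<in> ball a \<rho>" for z
    using h(2)[OF that] by (simp add: k_def)
  \<comment> \<open>Away from \<open>a\<close> this is a quotient of holomorphic functions, near
    \<open>a\<close> it coincides with \<open>h\<close>.\<close>
  have k: "k holomorphic_on ball 0 R"
  proof (rule no_isolated_singularity[where K = "{a}"])
    have "k holomorphic_on ball 0 R - {a}"
      unfolding k_def
      by (rule holomorphic_transform[of "\<lambda>z. f z / (z - a)^n"])
         (auto intro!: holomorphic_intros holomorphic_on_subset[OF f(1)])
    moreover have "k holomorphic_on ball a \<rho>"
      using h(1) by (rule holomorphic_transform) (use kh in simp)
    ultimately have "k holomorphic_on (ball 0 R - {a}) \<union> ball a \<rho>"
      by (intro holomorphic_on_Un) auto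
    moreover have "(ball 0 R - {a}) \<union> ball a \<rho> = ball 0 R"
      using n by (auto dest: subsetD)
    ultimately have "k holomorphic_on ball 0 R" by simp
    then show "continuous_on (ball 0 R) k" "k holomorphic_on ball 0 R - {a}"
      by (auto intro: holomorphic_on_imp_continuous_on holomorphic_on_subset)
  qed auto
  have fk: "f z = (z - a)^n * k z" for z
    using a n by (simp add: k_def)
  define b where "b z = (of_real (r\<^sup>2) - cnj a * z) / of_real r" for z
  have ble: "norm (z - a) \<le> norm (b z)" if "norm z < r" for z
    unfolding b_def using that a r by (intro norm_Blaschke_denominator_le) auto
  have bnz: "b z \<noteq> 0" if "norm z < r" for z
  proof
    assume "b z = 0"
    then have "of_real (r\<^sup>2) = cnj a * z" using r by (simp add: b_def)
    then have "r\<^sup>2 = norm a * norm z" by (metis complex_mod_cnj norm_mult norm_of_real abs_power2)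
    moreover have "norm a * norm z < r * r"
      using that a r by (intro mult_strict_mono) auto
    ultimately show False by (simp add: power2_eq_square)
  qed
  show ?thesis
  proof
    show "(\<lambda>z. b z ^ n * k z) holomorphic_on ball 0 R"
      unfolding b_def using r by (intro holomorphic_intros k) auto
    show "b z ^ n * k z = 0 \<longleftrightarrow> f z = 0 \<and> z \<noteq> a" if "norm z < r" for z
    proof (cases "z = a")
      case True
      then show ?thesis using h(3)[of a] n bnz[OF that] by (simp add: k_def)
    next
      case False
      then show ?thesis using bnz[OF that] by (simp add: fk)
    qed
    show "norm (f z) \<le> norm (b z ^ n * k z)" if "norm z < r" for z
      using ble[OF that] by (auto simp: fk norm_mult norm_power intro!: mult_right_mono power_mono)
    show "norm (b z ^ n * k z) = norm (f z)" if "norm z = r" for z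
      using norm_Blaschke_denominator_circle[OF that r(1), of a]
      by (simp add: fk norm_mult norm_power b_def)
  qed
qed

text \<open>Without zeros, \<open>f\<close> has a holomorphic \<open>p\<close>-th power. Dividing out Blaschke factors one zero at a time
  reduces to this case: it keeps the modulus on the circle and does not decrease it inside.\<close>

proposition norm_powr_le_circle_mean:
  fixes f :: "complex \<Rightarrow> complex"
  assumes f: "f holomorphic_on ball 0 R" and r: "norm w < r" "r < R" and p: "0 < p"
  shows "norm (f w) powr p \<le>
    r / (r - norm w) * integral {0..1} (\<lambda>\<theta>. norm (f (of_real r * cis (2 * pi * \<theta>))) powr p)"
proof -
  have r0: "0 < r" using r(1) norm_ge_zero[of w] by linarith
  \<comment> \<open>Constants are treated separately: the zero function has infinitely many zeros,
    and removing the zeros of a nonconstant function can leave a constant.\<close>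
  have const: "norm (g w) powr p \<le>
      r / (r - norm w) * integral {0..1} (\<lambda>\<theta>. norm (g (of_real r * cis (2 * pi * \<theta>))) powr p)"
    if g: "g constant_on ball 0 R" for g :: "complex \<Rightarrow> complex"
  proof -
    obtain c where c: "\<And>z. z \<in> ball 0 R \<Longrightarrow> g z = c" using g unfolding constant_on_def by blast
    have "norm c powr p \<le> r / (r - norm w) * norm c powr p"
      using mult_right_mono[of 1 "r / (r - norm w)" "norm c powr p"] r r0 by (simp add: field_simps)
    then show ?thesis
      using r r0 by (simp add: c norm_mult)
  qed
  have fin: "finite {z \<in> ball 0 r. g z = 0}"
    if "g holomorphic_on ball 0 R" "\<not> g constant_on ball 0 R" for g
    by (rule finite_subset[OF _ holomorphic_compact_finite_zeros[OF that(1) open_ball connected_ball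
           compact_cball[of 0 r] _ that(2)]])
       (use r in auto)
  have nonconst: "norm (f w) powr p \<le>
      r / (r - norm w) * integral {0..1} (\<lambda>\<theta>. norm (f (of_real r * cis (2 * pi * \<theta>))) powr p)"
    if "\<not> f constant_on ball 0 R"
    using f that
  proof (induction "card {z \<in> ball 0 r. f z = 0}" arbitrary: f)
    case 0
    then have "{z \<in> ball 0 r. f z = 0} = {}" using fin by auto
    then show ?case
      using norm_powr_le_circle_mean_nonvanishing[OF 0(2) r p] by auto
  next
    case (Suc n)
    from Suc(2) have "{z \<in> ball 0 r. f z = 0} \<noteq> {}" by (metis card.empty nat.distinct(1))
    then obtain a where a: "norm a < r" "f a = 0" by auto
    obtain g where g: "g holomorphic_on ball 0 R"
      "\<And>z. norm z < r \<Longrightarrow> g z = 0 \<longleftrightarrow> f z = 0 \<and> z \<noteq> a"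
      "\<And>z. norm z < r \<Longrightarrow> norm (f z) \<le> norm (g z)"
      "\<And>z. norm z = r \<Longrightarrow> norm (g z) = norm (f z)"
      using remove_zero_Blaschke[OF Suc(3,4) r0 r(2) a] by metis
    have Z: "{z \<in> ball 0 r. g z = 0} = {z \<in> ball 0 r. f z = 0} - {a}"
      using g(2) by auto
    then have card: "n = card {z \<in> ball 0 r. g z = 0}"
      using Suc(2) a fin[OF Suc(3,4)] by simp
    have int: "integral {0..1} (\<lambda>\<theta>. norm (g (of_real r * cis (2 * pi * \<theta>))) powr p)
        = integral {0..1} (\<lambda>\<theta>. norm (f (of_real r * cis (2 * pi * \<theta>))) powr p)"
      using g(4) r0 by (simp add: norm_mult)
    have "norm (g w) powr p \<le>
      r / (r - norm w) * integral {0..1} (\<lambda>\<theta>. norm (g (of_real r * cis (2 * pi * \<theta>))) powr p)"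
      using const Suc(1)[OF card g(1)] by blast
    moreover have "norm (f w) powr p \<le> norm (g w) powr p"
      using g(3)[OF r(1)] p by (intro powr_mono2) auto
    ultimately show ?case unfolding int by linarith
  qed
  then show ?thesis using const by blast
qed

section \<open>Poisson integrals in the half-plane\<close>

text \<open>For \<open>0 < Re w\<close>, the Moebius map of the unit disc onto the half-plane that
  sends 0 to \<open>w\<close> and the boundary point 1 to infinity.\<close>

definition half_plane_map :: "complex \<Rightarrow> complex \<Rightarrow> complex" where
  "half_plane_map w \<zeta> = (w + cnj w * \<zeta>) / (1 - \<zeta>)"

text \<open>The density at height \<open>t\<close> on the imaginary axis of harmonic measure seen
  from \<open>w\<close>, normalised to total mass 1.\<close>

definition poisson_kernel :: "complex \<Rightarrow> real \<Rightarrow> real" where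
  "poisson_kernel w t = Re w / (pi * ((Re w)\<^sup>2 + (t - Im w)\<^sup>2))"

section \<open>Conformal map and boundary parametrisation\<close>

lemma half_plane_map_0 [simp]: "half_plane_map w 0 = w"
  by (simp add: half_plane_map_def)

lemma holomorphic_half_plane_map: "half_plane_map w holomorphic_on ball 0 1"
  unfolding half_plane_map_def by (intro holomorphic_intros) auto

lemma Re_half_plane_map:
  "Re (half_plane_map w \<zeta>) = Re w * (1 - (norm \<zeta>)\<^sup>2) / (norm (1 - \<zeta>))\<^sup>2"
proof -
  have "Re ((w + cnj w * \<zeta>) * cnj (1 - \<zeta>)) = Re w * (1 - (norm \<zeta>)\<^sup>2)"
    unfolding cmod_power2 by (simp add: algebra_simps power2_eq_square)
  moreover have "half_plane_map w \<zeta> = (w + cnj w * \<zeta>) * cnj (1 - \<zeta>) / of_real ((norm (1 - \<zeta>))\<^sup>2)"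
    unfolding half_plane_map_def by (subst complex_div_cnj) (simp only: of_real_power)
  ultimately show ?thesis
    by (simp only: Re_divide_of_real)
qed

lemma Re_half_plane_map_pos:
  assumes "0 < Re w" "norm \<zeta> < 1"
  shows "0 < Re (half_plane_map w \<zeta>)"
proof -
  have "\<zeta> \<noteq> 1" using assms by auto
  moreover have "(norm \<zeta>)\<^sup>2 < 1" using assms by (simp add: power_less_one_iff)
  ultimately show ?thesis
    unfolding Re_half_plane_map using assms by (intro divide_pos_pos mult_pos_pos) auto
qed

text \<open>The angle comes from inverting the map on the boundary: with
  \<open>s = (t - Im w) / Re w\<close> the preimage of \<open>\<i> * t\<close> is
  \<open>- (1 - \<i> * s) / (1 + \<i> * s)\<close>, which has argument
  \<open>pi - 2 * arctan s\<close>.\<close>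

lemma half_plane_map_circle:
  assumes w: "0 < Re w"
  shows "half_plane_map w (cis (2 * pi * (1 / 2 - arctan ((t - Im w) / Re w) / pi))) = \<i> * of_real t"
proof -
  define s where "s = (t - Im w) / Re w"
  define x where "x = arctan s"
  have cx: "cos x \<noteq> 0" unfolding x_def by simp
  have sx: "sin x = s * cos x"
    using tan_arctan[of s] cx unfolding x_def by (simp add: tan_def field_simps)
  have "cis (2 * pi * (1 / 2 - arctan s / pi)) = cis (pi - 2 * x)"
    by (simp add: x_def right_diff_distrib)
  also have "\<dots> = - (cis (- x) / cis x)"
    by (simp add: cis_divide complex_eq_iff)
  also have "\<dots> = - ((1 - \<i> * s) / (1 + \<i> * s))"
  proof -
    have "cis (- x) = of_real (cos x) * (1 - \<i> * s)" "cis x = of_real (cos x) * (1 + \<i> * s)"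
      by (auto simp: complex_eq_iff sx mult.commute)
    then show ?thesis using cx by simp
  qed
  finally have z: "cis (2 * pi * (1 / 2 - arctan s / pi)) = - ((1 - \<i> * s) / (1 + \<i> * s))" .
  have nz: "1 + \<i> * s \<noteq> 0" by (simp add: complex_eq_iff)
  have t: "of_real t = of_real (Im w) + of_real (Re w) * (of_real s :: complex)"
    using w by (simp add: s_def flip: of_real_add of_real_mult)
  have "half_plane_map w (- ((1 - \<i> * s) / (1 + \<i> * s)))
      = (w * (1 + \<i> * s) - cnj w * (1 - \<i> * s)) / ((1 + \<i> * s) + (1 - \<i> * s))"
    unfolding half_plane_map_def using nz by (simp add: divide_simps)
  also have "\<dots> = \<i> * of_real t"
    unfolding t by (simp add: complex_eq_iff algebra_simps)
  finally show ?thesis using z by (simp only: s_def)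
qed

lemma poisson_kernel_pos: "0 < Re w \<Longrightarrow> 0 < poisson_kernel w t"
  unfolding poisson_kernel_def by (intro divide_pos_pos mult_pos_pos add_pos_nonneg) auto

text \<open>Normalised arc length on the circle pulls back to the Poisson kernel; the sign is
  negative because the angle decreases as \<open>t\<close> grows.\<close>

lemma DERIV_circle_param:
  assumes w: "0 < Re w"
  shows "((\<lambda>t. 1 / 2 - arctan ((t - Im w) / Re w) / pi) has_field_derivative - poisson_kernel w t)
    (at t within S)"
proof -
  have "((\<lambda>t. 1 / 2 - arctan ((t - Im w) / Re w) / pi) has_field_derivative
      - (1 / Re w * inverse (1 + ((t - Im w) / Re w)\<^sup>2) / pi)) (at t within S)"
    using w by (auto intro!: derivative_eq_intros)
  also have "1 / Re w * inverse (1 + ((t - Im w) / Re w)\<^sup>2) / pi = poisson_kernel w t"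
  proof -
    have "0 < (Re w)\<^sup>2 + (t - Im w)\<^sup>2" using w by (intro add_pos_nonneg) auto
    moreover have "1 + ((t - Im w) / Re w)\<^sup>2 = ((Re w)\<^sup>2 + (t - Im w)\<^sup>2) / (Re w)\<^sup>2"
      using w by (simp add: field_simps)
    ultimately show ?thesis
      using w unfolding poisson_kernel_def by (simp add: field_simps power2_eq_square)
  qed
  finally show ?thesis .
qed

text \<open>The endpoints 0 and 1 are left out: both stand for the point 1 of the circle, which the
  map sends to infinity.\<close>

lemma range_circle_param:
  assumes w: "0 < Re w"
  shows "range (\<lambda>t. 1 / 2 - arctan ((t - Im w) / Re w) / pi) = {0<..<1}"
proof (intro equalityI subsetI)
  fix \<theta> assume "\<theta> \<in> range (\<lambda>t. 1 / 2 - arctan ((t - Im w) / Re w) / pi)"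
  then obtain t where "\<theta> = 1 / 2 - arctan ((t - Im w) / Re w) / pi" by auto
  moreover have "\<bar>arctan ((t - Im w) / Re w) / pi\<bar> < 1 / 2"
    using arctan_lbound[of "(t - Im w) / Re w"] arctan_ubound[of "(t - Im w) / Re w"]
    by (simp add: abs_less_iff field_simps)
  ultimately show "\<theta> \<in> {0<..<1}"
    unfolding abs_less_iff greaterThanLessThan_iff by linarith
next
  fix \<theta> :: real assume \<theta>: "\<theta> \<in> {0<..<1}"
  define x where "x = pi * (1 / 2 - \<theta>)"
  have "0 < pi * \<theta>" "pi * \<theta> < pi" using \<theta> by auto
  then have "- (pi / 2) < x" "x < pi / 2" by (simp_all add: x_def algebra_simps)
  then have "\<theta> = 1 / 2 - arctan ((Im w + Re w * tan x - Im w) / Re w) / pi"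
    using w by (simp add: arctan_tan) (simp add: x_def)
  then show "\<theta> \<in> range (\<lambda>t. 1 / 2 - arctan ((t - Im w) / Re w) / pi)" by blast
qed

text \<open>The images of the circles of radius \<open>r < 1\<close> exhaust the half-plane as \<open>r\<close> tends to 1. Dominated
  convergence on the parameter interval then yields the Poisson integral of the boundary values, with
  no boundary behaviour of harmonic functions to be studied.\<close>

lemma circle_means_tendsto_Poisson:
  fixes u :: "complex \<Rightarrow> real"
  assumes w: "0 < Re w" and cont: "continuous_on {z. 0 \<le> Re z} u"
    and bdd: "\<And>z. 0 \<le> Re z \<Longrightarrow> norm (u z) \<le> B"
    and r: "r \<longlonglongrightarrow> 1" "\<And>n. 0 \<le> r n" "\<And>n. r n < (1::real)"
  shows "(\<lambda>t. poisson_kernel w t * u (\<i> * of_real t)) absolutely_integrable_on UNIV"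
    and "(\<lambda>n. integral {0..1} (\<lambda>\<theta>. u (half_plane_map w (of_real (r n) * cis (2 * pi * \<theta>)))))
      \<longlonglongrightarrow> integral UNIV (\<lambda>t. poisson_kernel w t * u (\<i> * of_real t))"
proof -
  define q where "q \<theta> = u (half_plane_map w (cis (2 * pi * \<theta>)))" for \<theta>
  let ?g = "\<lambda>t. 1 / 2 - arctan ((t - Im w) / Re w) / pi"
  have inI: "cis (2 * pi * \<theta>) \<noteq> 1" "0 \<le> Re (half_plane_map w (cis (2 * pi * \<theta>)))"
    if \<theta>: "\<theta> \<in> {0<..<1}" for \<theta>
  proof -
    obtain t where t: "\<theta> = ?g t" using \<theta> unfolding range_circle_param[OF w, symmetric] by blast
    show "0 \<le> Re (half_plane_map w (cis (2 * pi * \<theta>)))"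
      unfolding t half_plane_map_circle[OF w] by simp
    show "cis (2 * pi * \<theta>) \<noteq> 1"
    proof
      assume "cis (2 * pi * \<theta>) = 1"
      then have "cos (2 * pi * \<theta>) = 1" by (simp add: complex_eq_iff)
      then obtain k :: int where "2 * pi * \<theta> = of_int k * 2 * pi"
        by (metis cos_one_2pi_int)
      then have "\<theta> = of_int k" by simp
      then show False using \<theta> by auto
    qed
  qed
  have "continuous_on {0<..<1} (\<lambda>\<theta>. half_plane_map w (cis (2 * pi * \<theta>)))"
    unfolding half_plane_map_def using inI(1) by (intro continuous_intros) force
  then have "continuous_on {0<..<1} q"
    unfolding q_def by (rule continuous_on_compose2[OF cont]) (use inI(2) in auto)
  then have qm: "q \<in> borel_measurable (lebesgue_on {0<..<1})"
    by (intro continuous_imp_measurable_on_sets_lebesgue) auto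
  have q_abs: "q absolutely_integrable_on {0<..<1}"
  proof (rule measurable_bounded_by_integrable_imp_absolutely_integrable[OF qm])
    show "(\<lambda>_::real. B) integrable_on {0<..<1::real}"
      by (simp add: integrable_on_open_interval_real integrable_const_ivl)
    show "norm (q x) \<le> B" if "x \<in> {0<..<1}" for x
      unfolding q_def using inI[OF that] by (intro bdd) auto
  qed auto
  \<comment> \<open>Change of variables produces the absolute value of the derivative, which is the
    kernel itself since the kernel is positive.\<close>
  have sub: "(\<lambda>t. poisson_kernel w t * u (\<i> * of_real t)) = (\<lambda>t. \<bar>- poisson_kernel w t\<bar> * q (?g t))"
    using poisson_kernel_pos[OF w] by (simp add: q_def half_plane_map_circle[OF w] less_imp_le)
  have inj: "inj ?g"
    using w by (auto intro!: injI simp: arctan_eq_iff)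
  have int: "(\<lambda>t. \<bar>- poisson_kernel w t\<bar> * q (?g t)) absolutely_integrable_on UNIV \<and>
      integral UNIV (\<lambda>t. \<bar>- poisson_kernel w t\<bar> * q (?g t)) = integral {0<..<1} q"
    using has_absolute_integral_change_of_variables_1'[OF _ DERIV_circle_param[OF w] inj, of q "integral {0<..<1} q"]
      q_abs unfolding range_circle_param[OF w] by simp
  then show "(\<lambda>t. poisson_kernel w t * u (\<i> * of_real t)) absolutely_integrable_on UNIV"
    unfolding sub by blast
  show "(\<lambda>n. integral {0..1} (\<lambda>\<theta>. u (half_plane_map w (of_real (r n) * cis (2 * pi * \<theta>)))))
      \<longlonglongrightarrow> integral UNIV (\<lambda>t. poisson_kernel w t * u (\<i> * of_real t))"
  unfolding sub proof -
    let ?f = "\<lambda>n \<theta>. u (half_plane_map w (of_real (r n) * cis (2 * pi * \<theta>)))"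
    have inr: "norm (of_real (r n) * cis (2 * pi * \<theta>)) < 1" for n \<theta>
      using r(2,3)[of n] by (simp add: norm_mult)
    have cont_f: "continuous_on {0..1} (?f n)" for n
      using inr Re_half_plane_map_pos[OF w]
      by (intro continuous_on_compose2[OF cont]
            continuous_on_compose2[OF holomorphic_on_imp_continuous_on[OF holomorphic_half_plane_map]])
         (auto intro!: continuous_intros simp: less_imp_le)
    \<comment> \<open>Pointwise convergence is available on the open interval, where the limit point
      is finite; dropping the endpoints leaves the integrals unchanged.\<close>
    have "(\<lambda>n. integral {0<..<1} (?f n)) \<longlonglongrightarrow> integral {0<..<1} q"
    proof (rule dominated_convergence)
      show "?f n integrable_on {0<..<1}" for n
        using integrable_continuous_interval[OF cont_f] by (simp add: integrable_on_open_interval_real)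
      show "(\<lambda>_::real. B) integrable_on {0<..<1::real}"
        by (simp add: integrable_on_open_interval_real integrable_const_ivl)
      show "norm (?f n \<theta>) \<le> B" for n \<theta>
        using Re_half_plane_map_pos[OF w inr] by (intro bdd) (simp add: less_imp_le)
      show "(\<lambda>n. ?f n \<theta>) \<longlonglongrightarrow> q \<theta>" if "\<theta> \<in> {0<..<1}" for \<theta>
        unfolding q_def
      proof (rule continuous_on_tendsto_compose[OF cont])
        have "(\<lambda>n. half_plane_map w (of_real (r n) * cis (2 * pi * \<theta>)))
            \<longlonglongrightarrow> half_plane_map w (of_real 1 * cis (2 * pi * \<theta>))"
          unfolding half_plane_map_def using inI(1)[OF that] by (intro tendsto_intros r) auto
        then show "(\<lambda>n. half_plane_map w (of_real (r n) * cis (2 * pi * \<theta>)))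
            \<longlonglongrightarrow> half_plane_map w (cis (2 * pi * \<theta>))" by simp
      qed (use inI[OF that] Re_half_plane_map_pos[OF w inr] in \<open>auto simp: less_imp_le\<close>)
    qed
    then show "(\<lambda>n. integral {0..1} (?f n)) \<longlonglongrightarrow> integral UNIV (\<lambda>t. \<bar>- poisson_kernel w t\<bar> * q (?g t))"
      using int by (simp add: integral_open_interval_real)
  qed
qed

section \<open>Poisson inequality and Poisson formula in the half-plane\<close>

lemma nn_integral_eq_integral_lborel:
  fixes f :: "real \<Rightarrow> real"
  assumes "f \<in> borel_measurable borel" "\<And>x. 0 \<le> f x" "f integrable_on UNIV"
  shows "(\<integral>\<^sup>+x. ennreal (f x) \<partial>lborel) = ennreal (integral UNIV f)"
  using nn_integral_has_integral_lborel[OF assms(1,2) integrable_integral[OF assms(3)]] by simp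

lemma continuous_on_poisson_kernel:
  assumes "continuous_on S f" "continuous_on S g" "\<And>x. x \<in> S \<Longrightarrow> 0 < Re (f x)"
  shows "continuous_on S (\<lambda>x. poisson_kernel (f x) (g x))"
proof -
  have "(Re (f x))\<^sup>2 + (g x - Im (f x))\<^sup>2 \<noteq> 0" if "x \<in> S" for x
    using assms(3)[OF that] by (metis add_pos_nonneg less_numeral_extra(3) zero_le_power2 zero_less_power)
  then show ?thesis
    unfolding poisson_kernel_def using assms(1,2) by (intro continuous_intros) auto
qed

lemma borel_measurable_poisson_mult:
  fixes u :: "complex \<Rightarrow> real"
  assumes "0 < Re w" "continuous_on {z. 0 \<le> Re z} u"
  shows "(\<lambda>t. poisson_kernel w t * u (\<i> * of_real t)) \<in> borel_measurable borel"
  using assms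
  by (intro borel_measurable_continuous_onI continuous_on_mult continuous_on_poisson_kernel
        continuous_on_compose2[OF assms(2)]) (auto intro!: continuous_intros)

lemma obtain_radii:
  obtains r :: "nat \<Rightarrow> real" where "r \<longlonglongrightarrow> 1" "\<And>n. 0 < r n" "\<And>n. r n < 1"
proof
  show "(\<lambda>n. real (Suc n) / real (Suc (Suc n))) \<longlonglongrightarrow> 1"
    by (rule LIMSEQ_Suc[OF LIMSEQ_n_over_Suc_n])
qed auto

lemma holomorphic_on_half_plane_map_comp:
  assumes "f holomorphic_on {z. 0 < Re z}" "0 < Re w"
  shows "(\<lambda>\<zeta>. f (half_plane_map w \<zeta>)) holomorphic_on ball 0 1"
  using holomorphic_on_compose_gen[OF holomorphic_half_plane_map assms(1), of w]
    Re_half_plane_map_pos[OF assms(2)] by (auto simp: o_def image_subset_iff)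

text \<open>The circle-mean inequality at the centre of the disc, transported by
  \<open>half_plane_map\<close>. Its correction factor is 1 at the centre, so the limit of the radii
  gives constant 1.\<close>

lemma Poisson_majorant_powr:
  fixes f :: "complex \<Rightarrow> complex"
  assumes f: "f holomorphic_on {z. 0 < Re z}" "continuous_on {z. 0 \<le> Re z} f"
    and B: "\<And>z. 0 \<le> Re z \<Longrightarrow> norm (f z) \<le> B" and w: "0 < Re w" and p: "0 < p"
  shows "ennreal (norm (f w) powr p)
    \<le> (\<integral>\<^sup>+t. ennreal (poisson_kernel w t * norm (f (\<i> * of_real t)) powr p) \<partial>lborel)"
proof -
  obtain r :: "nat \<Rightarrow> real" where r: "r \<longlonglongrightarrow> 1" "\<And>n. 0 < r n" "\<And>n. r n < 1"
    using obtain_radii by blast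
  let ?u = "\<lambda>z. norm (f z) powr p"
  have cont: "continuous_on {z. 0 \<le> Re z} ?u"
    using f(2) p by (intro continuous_on_powr') (auto intro!: continuous_intros)
  have bdd: "norm (?u z) \<le> B powr p" if "0 \<le> Re z" for z
    using B[OF that] p by (auto intro!: powr_mono2)
  have r0: "0 \<le> r n" for n using r(2)[of n] by simp
  note lim = circle_means_tendsto_Poisson[OF w cont bdd r(1) r0 r(3)]
  have le: "norm (f w) powr p \<le> integral UNIV (\<lambda>t. poisson_kernel w t * ?u (\<i> * of_real t))"
  proof (rule tendsto_lowerbound[OF lim(2)])
    show "\<forall>\<^sub>F n in sequentially. norm (f w) powr p \<le>
      integral {0..1} (\<lambda>\<theta>. ?u (half_plane_map w (of_real (r n) * cis (2 * pi * \<theta>))))"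
    proof (rule always_eventually, rule allI)
      fix n
      show "norm (f w) powr p \<le> integral {0..1} (\<lambda>\<theta>. ?u (half_plane_map w (of_real (r n) * cis (2 * pi * \<theta>))))"
        using norm_powr_le_circle_mean[OF holomorphic_on_half_plane_map_comp[OF f(1) w], of 0 "r n" p]
          r(2)[of n] r(3)[of n] p by simp
    qed
  qed simp_all
  have "ennreal (integral UNIV (\<lambda>t. poisson_kernel w t * ?u (\<i> * of_real t)))
      = (\<integral>\<^sup>+t. ennreal (poisson_kernel w t * ?u (\<i> * of_real t)) \<partial>lborel)"
    using lim(1) poisson_kernel_pos[OF w]
    by (intro nn_integral_eq_integral_lborel[symmetric] borel_measurable_poisson_mult[OF w cont])
       (auto intro: set_lebesgue_integral_eq_integral(1) simp: less_imp_le)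
  then show ?thesis using ennreal_leI[OF le] by simp
qed

text \<open>Cauchy's formula at the centre makes every circle mean of the real part equal to
  \<open>Re (f w)\<close>, hence an equality in the limit. Boundedness excludes functions such as
  \<open>z\<close> itself, whose real part vanishes on the axis.\<close>

lemma Poisson_Re:
  fixes f :: "complex \<Rightarrow> complex"
  assumes f: "f holomorphic_on {z. 0 < Re z}" "continuous_on {z. 0 \<le> Re z} f"
    and B: "\<And>z. 0 \<le> Re z \<Longrightarrow> norm (f z) \<le> B" and w: "0 < Re w"
    and nonneg: "\<And>z. 0 \<le> Re z \<Longrightarrow> 0 \<le> Re (f z)"
  shows "(\<integral>\<^sup>+t. ennreal (poisson_kernel w t * Re (f (\<i> * of_real t))) \<partial>lborel) = ennreal (Re (f w))"
proof -
  obtain r :: "nat \<Rightarrow> real" where r: "r \<longlonglongrightarrow> 1" "\<And>n. 0 < r n" "\<And>n. r n < 1"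
    using obtain_radii by blast
  have cont: "continuous_on {z. 0 \<le> Re z} (\<lambda>z. Re (f z))"
    using f(2) by (intro continuous_intros)
  have bdd: "norm (Re (f z)) \<le> B" if "0 \<le> Re z" for z
    using B[OF that] abs_Re_le_cmod[of "f z"] by simp
  have r0: "0 \<le> r n" for n using r(2)[of n] by simp
  note lim = circle_means_tendsto_Poisson[OF w cont bdd r(1) r0 r(3)]
  have "integral {0..1} (\<lambda>\<theta>. Re (f (half_plane_map w (of_real (r n) * cis (2 * pi * \<theta>))))) = Re (f w)" for n
  proof -
    have "((\<lambda>\<theta>. f (half_plane_map w (of_real (r n) * cis (2 * pi * \<theta>)))) has_integral f w) {0..1}"
      using Cauchy_integral_circle[OF holomorphic_on_half_plane_map_comp[OF f(1) w], of 0 "r n"] r(2)[of n] r(3)[of n]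
      by simp
    from has_integral_linear[OF this bounded_linear_Re] show ?thesis
      by (intro integral_unique) (simp add: o_def)
  qed
  then have "integral UNIV (\<lambda>t. poisson_kernel w t * Re (f (\<i> * of_real t))) = Re (f w)"
    using LIMSEQ_unique[OF lim(2), of "Re (f w)"] by simp
  then show ?thesis
    using lim(1) poisson_kernel_pos[OF w] nonneg
    by (subst nn_integral_eq_integral_lborel[OF borel_measurable_poisson_mult[OF w cont]])
       (auto intro: set_lebesgue_integral_eq_integral(1) simp: less_imp_le)
qed

section \<open>Hardy spaces and the upper bound\<close>

lemma mem_right_half_plane [simp]: "z \<in> right_half_plane \<longleftrightarrow> 0 < Re z"
  by (simp add: right_half_plane_def)

lemma borel_measurable_powr_norm:
  fixes f :: "complex \<Rightarrow> complex" and g :: "'a :: second_countable_topology \<Rightarrow> complex"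
  assumes "f holomorphic_on right_half_plane" "continuous_on UNIV g" "\<And>x. 0 < Re (g x)"
  shows "(\<lambda>x. norm (f (g x)) powr p) \<in> borel_measurable borel"
proof -
  have "continuous_on UNIV (\<lambda>x. f (g x))"
    using assms(3)
    by (intro continuous_on_compose2[OF holomorphic_on_imp_continuous_on[OF assms(1)] assms(2)]) auto
  then have "(\<lambda>x. norm (f (g x))) \<in> borel_measurable borel"
    by (intro borel_measurable_continuous_onI continuous_on_norm)
  then show ?thesis by measurable
qed

lemma hardy_sup_line_le:
  assumes "0 < x"
  shows "(\<integral>\<^sup>+y. ennreal (norm (f (Complex x y)) powr p) \<partial>lborel) \<le> ennreal (2 * pi) * hardy_sup p f"
proof -
  let ?I = "\<integral>\<^sup>+y. ennreal (norm (f (Complex x y)) powr p) \<partial>lborel"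
  have "ennreal (1 / (2 * pi)) * ?I \<le> hardy_sup p f"
    unfolding hardy_sup_def using assms by (intro SUP_upper) auto
  then have "ennreal (2 * pi) * (ennreal (1 / (2 * pi)) * ?I) \<le> ennreal (2 * pi) * hardy_sup p f"
    by (rule mult_left_mono) simp
  then show ?thesis
    by (simp add: mult.assoc[symmetric] ennreal_mult[symmetric])
qed

lemma hardy_sup_leI:
  assumes "\<And>x. 0 < x \<Longrightarrow> (\<integral>\<^sup>+y. ennreal (norm (f (Complex x y)) powr p) \<partial>lborel) \<le> ennreal (2 * pi) * C"
  shows "hardy_sup p f \<le> C"
  unfolding hardy_sup_def
proof (rule SUP_least)
  fix x :: real assume "x \<in> {0<..}"
  then have "ennreal (1 / (2 * pi)) * (\<integral>\<^sup>+y. ennreal (norm (f (Complex x y)) powr p) \<partial>lborel)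
      \<le> ennreal (1 / (2 * pi)) * (ennreal (2 * pi) * C)"
    by (intro mult_left_mono assms) auto
  also have "\<dots> = C" by (simp add: mult.assoc[symmetric] ennreal_mult[symmetric])
  finally show "ennreal (1 / (2 * pi)) * (\<integral>\<^sup>+y. ennreal (norm (f (Complex x y)) powr p) \<partial>lborel) \<le> C" .
qed

section \<open>Boundedness on smaller half-planes\<close>

lemma nn_integral_lborel_shift:
  fixes g :: "real \<Rightarrow> ennreal"
  assumes "g \<in> borel_measurable borel"
  shows "(\<integral>\<^sup>+s. g (t + s) \<partial>lborel) = (\<integral>\<^sup>+s. g s \<partial>lborel)"
  using nn_integral_real_affine[OF assms, of 1 t] by simp

text \<open>The circle means are averaged over discs whose centres move along a vertical segment through
  the given point; only integrals over whole vertical lines then appear.\<close>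

lemma hardy_space_bounded:
  assumes f: "f \<in> hardy_space p" and p: "0 < p" and \<epsilon>: "0 < \<epsilon>"
  obtains B where "\<And>z. \<epsilon> \<le> Re z \<Longrightarrow> norm (f z) \<le> B"
proof -
  have hol: "f holomorphic_on right_half_plane" and fin: "hardy_sup p f < \<infinity>"
    using f by (auto simp: hardy_space_def)
  \<comment> \<open>Circles of radius \<open>r\<close> about points with real part at least
    \<open>\<epsilon>\<close> stay in the half-plane, and offsets up to
    \<open>\<delta> = r / 2\<close> keep \<open>r / (r - s)\<close> at most 2.\<close>
  define r \<delta> where "r = \<epsilon> / 2" and "\<delta> = \<epsilon> / 4"
  have r: "0 < r" "0 < \<delta>" using \<epsilon> by (auto simp: r_def \<delta>_def)
  \<comment> \<open>The factor 2 is the bound on \<open>r / (r - s)\<close>; \<open>2 * pi\<close>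
    undoes the normalisation in \<open>hardy_sup\<close>.\<close>
  define K where "K = enn2real (2 * (ennreal (2 * pi) * hardy_sup p f))"
  have K: "2 * (ennreal (2 * pi) * hardy_sup p f) = ennreal K"
    using fin by (simp add: K_def ennreal_mult_less_top less_top[symmetric] ennreal_mult_eq_top_iff)
  have K0: "0 \<le> K" by (simp add: K_def)
  have main: "norm (f z) powr p \<le> K / \<delta>" if z: "\<epsilon> \<le> Re z" for z
  proof -
    \<comment> \<open>The first coordinate lifts the centre of the circle, the second runs around
      the circle.\<close>
    define g where "g x = z + \<i> * of_real (fst x) + of_real r * cis (2 * pi * snd x)" for x :: "real \<times> real"
    define v where "v x = norm (f (g x)) powr p" for x
    have Re_g: "0 < Re (g x)" for x
    proof -
      have "- r \<le> r * cos (2 * pi * snd x)"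
        using mult_left_mono[OF cos_ge_minus_one[of "2 * pi * snd x"], of r] r by simp
      then show ?thesis using z \<epsilon> by (simp add: g_def r_def)
    qed
    have cont_g: "continuous_on UNIV g"
      unfolding g_def by (intro continuous_intros)
    have vm: "(\<lambda>x. ennreal (v x)) \<in> borel_measurable (lborel \<Otimes>\<^sub>M lborel)"
      using borel_measurable_powr_norm[OF hol cont_g Re_g, of p]
      unfolding v_def by (simp add: borel_prod[symmetric] cong: measurable_cong_sets)
    have mean: "ennreal (norm (f z) powr p) \<le> (\<integral>\<^sup>+\<theta>. 2 * ennreal (v (s, \<theta>)) * indicator {0..1} \<theta> \<partial>lborel)"
      if s: "s \<in> {0..\<delta>}" for s
    proof -
      let ?F = "\<lambda>\<zeta>. f (z + \<i> * of_real s + \<zeta>)"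
      have F: "?F holomorphic_on ball 0 \<epsilon>"
      proof (rule holomorphic_on_compose_gen[OF _ hol, unfolded o_def])
        show "(\<lambda>\<zeta>. z + \<i> * of_real s + \<zeta>) ` ball 0 \<epsilon> \<subseteq> right_half_plane"
        proof (intro image_subsetI)
          fix \<zeta> :: complex assume "\<zeta> \<in> ball 0 \<epsilon>"
          then show "z + \<i> * of_real s + \<zeta> \<in> right_half_plane"
            using z abs_Re_le_cmod[of \<zeta>] by simp
        qed
      qed (intro holomorphic_intros)
      \<comment> \<open>Seen from the lifted centre, \<open>z\<close> lies at offset
        \<open>- \<i> * s\<close>; this is the off-centre use of the circle mean.\<close>
      have ns: "norm (- \<i> * of_real s) = s" using s by (simp add: norm_mult)
      have le: "norm (?F (- \<i> * of_real s)) powr p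
          \<le> r / (r - s) * integral {0..1} (\<lambda>\<theta>. norm (?F (of_real r * cis (2 * pi * \<theta>))) powr p)"
        using norm_powr_le_circle_mean[OF F, of "- \<i> * of_real s" r p] s p \<epsilon> unfolding ns
        by (simp add: r_def \<delta>_def)
      have I: "(\<lambda>\<theta>. v (s, \<theta>)) integrable_on {0..1}"
      proof -
        have "continuous_on {0..1} (\<lambda>\<theta>. norm (?F (of_real r * cis (2 * pi * \<theta>))) powr p)"
          using continuous_on_circle_param[OF F, of r "{0..1}"] r p \<epsilon>
          by (intro continuous_on_powr') (auto intro!: continuous_intros simp: r_def)
        then show ?thesis
          by (intro integrable_continuous_interval) (simp add: v_def g_def)
      qed
      have nonneg: "0 \<le> integral {0..1} (\<lambda>\<theta>. v (s, \<theta>))"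
        using I by (intro integral_nonneg) (auto simp: v_def)
      have "r / (r - s) \<le> 2" using s r by (simp add: r_def \<delta>_def field_simps)
      then have "norm (f z) powr p \<le> 2 * integral {0..1} (\<lambda>\<theta>. v (s, \<theta>))"
        using le mult_right_mono[OF _ nonneg, of "r / (r - s)" 2] by (simp add: v_def g_def)
      then have "ennreal (norm (f z) powr p) \<le> 2 * ennreal (integral {0..1} (\<lambda>\<theta>. v (s, \<theta>)))"
        using ennreal_leI nonneg by (force simp: ennreal_mult)
      also have "\<dots> = 2 * (\<integral>\<^sup>+\<theta>. ennreal (v (s, \<theta>)) * indicator {0..1} \<theta> \<partial>lborel)"
        using nn_integral_has_integral_lebesgue'[OF _ integrable_integral[OF I]] by (simp add: v_def)
      also have "\<dots> = (\<integral>\<^sup>+\<theta>. 2 * (ennreal (v (s, \<theta>)) * indicator {0..1} \<theta>) \<partial>lborel)"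
        using measurable_Pair2[OF vm, of s] by (intro nn_integral_cmult[symmetric]) auto
      finally show ?thesis by (simp add: mult.assoc)
    qed
    \<comment> \<open>For a fixed angle, varying \<open>s\<close> over the reals sweeps one whole
      vertical line, so the Hardy bound holds uniformly in the angle.\<close>
    have inner: "(\<integral>\<^sup>+s. ennreal (v (s, \<theta>)) \<partial>lborel) \<le> ennreal (2 * pi) * hardy_sup p f" for \<theta>
    proof -
      define x y where "x = Re (g (0, \<theta>))" and "y = Im (g (0, \<theta>))"
      have x: "0 < x" unfolding x_def by (rule Re_g)
      have "v (s, \<theta>) = norm (f (Complex x (y + s))) powr p" for s
      proof -
        have "g (s, \<theta>) = Complex x (y + s)"
          by (simp add: g_def x_def y_def complex_eq_iff)
        then show ?thesis by (simp add: v_def)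
      qed
      moreover have "(\<lambda>t. norm (f (Complex x t)) powr p) \<in> borel_measurable borel"
        using x by (intro borel_measurable_powr_norm[OF hol]) (auto simp: Complex_eq intro!: continuous_intros)
      ultimately show ?thesis
        using hardy_sup_line_le[OF x, of f p] nn_integral_lborel_shift[of "\<lambda>t. ennreal (norm (f (Complex x t)) powr p)" y]
        by simp
    qed
    \<comment> \<open>Integrating over \<open>s\<close> multiplies the constant left side by
      \<open>\<delta>\<close>; on the right the range of \<open>s\<close> is enlarged to the whole
      line before the integrals are exchanged.\<close>
    have "ennreal (norm (f z) powr p) * ennreal \<delta> = (\<integral>\<^sup>+s. ennreal (norm (f z) powr p) * indicator {0..\<delta>} s \<partial>lborel)"
      using r by (simp add: nn_integral_cmult_indicator)
    also have "\<dots> \<le> (\<integral>\<^sup>+s. (\<integral>\<^sup>+\<theta>. 2 * ennreal (v (s, \<theta>)) * indicator {0..1} \<theta> \<partial>lborel) \<partial>lborel)"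
      using mean by (intro nn_integral_mono) (auto simp: indicator_def)
    also have "\<dots> = (\<integral>\<^sup>+\<theta>. (\<integral>\<^sup>+s. 2 * ennreal (v (s, \<theta>)) * indicator {0..1} \<theta> \<partial>lborel) \<partial>lborel)"
    proof (rule lborel_pair.Fubini'[symmetric])
      show "(\<lambda>(s, \<theta>). 2 * ennreal (v (s, \<theta>)) * indicator {0..1} \<theta>) \<in> borel_measurable (lborel \<Otimes>\<^sub>M lborel)"
        using vm by (simp add: case_prod_unfold)
    qed
    also have "\<dots> = (\<integral>\<^sup>+\<theta>. 2 * (\<integral>\<^sup>+s. ennreal (v (s, \<theta>)) \<partial>lborel) * indicator {0..1} \<theta> \<partial>lborel)"
      using measurable_Pair1[OF vm]
      by (intro nn_integral_cong) (simp add: nn_integral_cmult nn_integral_multc)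
    also have "\<dots> \<le> (\<integral>\<^sup>+\<theta>. ennreal K * indicator {0..1} (\<theta> :: real) \<partial>lborel)"
      unfolding K[symmetric] by (intro nn_integral_mono mult_right_mono mult_left_mono inner) auto
    also have "\<dots> = ennreal K"
      by (simp add: nn_integral_cmult_indicator)
    finally have "norm (f z) powr p * \<delta> \<le> K"
      using K0 r by (simp add: ennreal_mult[symmetric])
    then show ?thesis using r by (simp add: field_simps)
  qed
  show ?thesis
  proof
    fix z assume "\<epsilon> \<le> Re z"
    from powr_mono2[OF _ _ main[OF this], of "1 / p"] p
    show "norm (f z) \<le> (K / \<delta>) powr (1 / p)" by (simp add: powr_powr)
  qed
qed

section \<open>Vertical integrals of the composed kernel and the upper bound\<close>

lemma poisson_kernel_altdef:
  "poisson_kernel w t = Re (1 / (w - \<i> * of_real t)) / pi"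
  by (simp add: poisson_kernel_def Re_divide power2_eq_square field_simps)

text \<open>Apply the Poisson formula to \<open>q z = 1 / (\<phi> (x + z) - \<i> * t)\<close> at a
  large real point \<open>R\<close>. There \<open>Re (q R)\<close> is at most
  \<open>1 / (c * (x + R))\<close>, while \<open>R\<close> times the kernel at \<open>R\<close>
  tends to \<open>1 / pi\<close>. Multiplying by \<open>R\<close> and using Fatou's lemma gives the
  bound \<open>1 / c\<close>.\<close>

lemma nn_integral_poisson_comp_le:
  assumes \<phi>: "\<phi> holomorphic_on right_half_plane" "\<And>z. 0 < Re z \<Longrightarrow> c * Re z \<le> Re (\<phi> z)"
    and c: "0 < c" and x: "0 < x"
  shows "(\<integral>\<^sup>+y. ennreal (poisson_kernel (\<phi> (Complex x y)) t) \<partial>lborel) \<le> ennreal (1 / c)"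
proof -
  define q where "q z = 1 / (\<phi> (of_real x + z) - \<i> * of_real t)" for z
  have Re_ge: "c * (x + Re z) \<le> Re (\<phi> (of_real x + z) - \<i> * of_real t)" if "0 \<le> Re z" for z
    using \<phi>(2)[of "of_real x + z"] that x by simp
  have pos: "0 < c * (x + Re z)" if "0 \<le> Re z" for z
    using that x c by simp
  have norm_q: "norm (q z) \<le> 1 / (c * (x + Re z))" if "0 \<le> Re z" for z
  proof -
    have "c * (x + Re z) \<le> norm (\<phi> (of_real x + z) - \<i> * of_real t)"
      using Re_ge[OF that] complex_Re_le_cmod order_trans by blast
    then show ?thesis
      unfolding q_def norm_divide using pos[OF that] by (simp add: frac_le)
  qed
  have nz: "\<phi> (of_real x + z) - \<i> * of_real t \<noteq> 0" if "0 \<le> Re z" for z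
    using Re_ge[OF that] pos[OF that] by auto
  have "(\<lambda>z. \<phi> (of_real x + z)) holomorphic_on {z. - x < Re z}"
    using x by (intro holomorphic_on_compose_gen[OF _ \<phi>(1), unfolded o_def] holomorphic_intros) auto
  then have hol0: "(\<lambda>z. \<phi> (of_real x + z)) holomorphic_on {z. 0 < Re z}"
    and cont0: "continuous_on {z. 0 \<le> Re z} (\<lambda>z. \<phi> (of_real x + z))"
    using x by (auto elim!: holomorphic_on_subset intro!: holomorphic_on_imp_continuous_on)
  have hol: "q holomorphic_on {z. 0 < Re z}"
    unfolding q_def using nz by (intro holomorphic_intros hol0) auto
  have cont: "continuous_on {z. 0 \<le> Re z} q"
    unfolding q_def using nz by (intro continuous_intros cont0) auto
  have bdd: "norm (q z) \<le> 1 / (c * x)" if "0 \<le> Re z" for z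
    using norm_q[OF that] x c that
    by (meson divide_left_mono le_add_same_cancel1 mult_left_mono mult_pos_pos order_trans less_imp_le zero_le_one pos)
  have Re_q: "0 \<le> Re (q z)" if "0 \<le> Re z" for z
    using Re_ge[OF that] pos[OF that] unfolding q_def Re_divide by simp
  \<comment> \<open>The successor keeps every \<open>R n\<close> positive.\<close>
  define R where "R n = real (Suc n)" for n
  define F where "F n y = ennreal (R n) * ennreal (poisson_kernel (of_real (R n)) y * Re (q (\<i> * of_real y)))" for n y
  have Fm: "F n \<in> borel_measurable lborel" for n
  proof -
    have "(\<lambda>y. poisson_kernel (of_real (R n)) y * Re (q (\<i> * of_real y))) \<in> borel_measurable borel"
      by (intro borel_measurable_poisson_mult[of _ "\<lambda>z. Re (q z)"] continuous_intros cont) (simp add: R_def)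
    then show ?thesis unfolding F_def by simp
  qed
  have Fint: "(\<integral>\<^sup>+y. F n y \<partial>lborel) \<le> ennreal (1 / c)" for n
  proof -
    have Rn: "0 < R n" by (simp add: R_def)
    have "(\<lambda>y. poisson_kernel (of_real (R n)) y * Re (q (\<i> * of_real y))) \<in> borel_measurable borel"
      using Rn by (intro borel_measurable_poisson_mult[of _ "\<lambda>z. Re (q z)"] continuous_intros cont) simp
    then have "(\<integral>\<^sup>+y. F n y \<partial>lborel) = ennreal (R n) * ennreal (Re (q (of_real (R n))))"
      unfolding F_def using Rn
      by (subst nn_integral_cmult) (auto simp: Poisson_Re[OF hol cont bdd _ Re_q])
    also have "\<dots> = ennreal (R n * Re (q (of_real (R n))))"
      using Rn Re_q[of "of_real (R n)"] by (simp add: ennreal_mult)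
    also have "\<dots> \<le> ennreal (1 / c)"
    proof (rule ennreal_leI)
      have "R n * Re (q (of_real (R n))) \<le> R n * (1 / (c * (x + R n)))"
        using norm_q[of "of_real (R n)"] complex_Re_le_cmod[of "q (of_real (R n))"] Rn
        by (intro mult_left_mono) auto
      also have "\<dots> = 1 / c * (R n / (x + R n))" by simp
      also have "\<dots> \<le> 1 / c * 1" using Rn x c by (intro mult_left_mono) auto
      finally show "R n * Re (q (of_real (R n))) \<le> 1 / c" by simp
    qed
    finally show ?thesis .
  qed
  have R_lim: "filterlim R at_top sequentially"
    unfolding R_def by (rule filterlim_compose[OF filterlim_real_sequentially filterlim_Suc])
  have Flim: "(\<lambda>n. F n y) \<longlonglongrightarrow> ennreal (poisson_kernel (\<phi> (Complex x y)) t)" for y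
  proof -
    have F_eq: "F n y = ennreal (1 / (1 + (y / R n)\<^sup>2) * (Re (q (\<i> * of_real y)) / pi))" for n
    proof -
      have Rn: "0 < R n" by (simp add: R_def)
      have "R n * (poisson_kernel (of_real (R n)) y * Re (q (\<i> * of_real y))) = 1 / (1 + (y / R n)\<^sup>2) * (Re (q (\<i> * of_real y)) / pi)"
      proof -
        have "0 < (R n)\<^sup>2 + y\<^sup>2" using Rn by (intro add_pos_nonneg) auto
        moreover have "1 + (y / R n)\<^sup>2 = ((R n)\<^sup>2 + y\<^sup>2) / (R n)\<^sup>2" using Rn by (simp add: field_simps)
        ultimately show ?thesis
          using Rn by (simp add: poisson_kernel_def field_simps power2_eq_square)
      qed
      then show ?thesis
        using Rn Re_q poisson_kernel_pos[of "of_real (R n)" y] unfolding F_def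
        by (subst ennreal_mult[symmetric]) (auto intro!: mult_nonneg_nonneg less_imp_le)
    qed
    have "(\<lambda>n. y / R n) \<longlonglongrightarrow> 0"
      by (intro tendsto_divide_0[OF tendsto_const] filterlim_at_top_imp_at_infinity R_lim)
    then have "(\<lambda>n. 1 / (1 + (y / R n)\<^sup>2) * (Re (q (\<i> * of_real y)) / pi))
        \<longlonglongrightarrow> 1 / (1 + 0\<^sup>2) * (Re (q (\<i> * of_real y)) / pi)"
      by (intro tendsto_intros) auto
    moreover have "of_real x + \<i> * of_real y = Complex x y" by (simp add: Complex_eq)
    ultimately show ?thesis
      unfolding F_eq poisson_kernel_altdef q_def by (intro tendsto_ennrealI) simp
  qed
  have "(\<integral>\<^sup>+y. ennreal (poisson_kernel (\<phi> (Complex x y)) t) \<partial>lborel) = (\<integral>\<^sup>+y. liminf (\<lambda>n. F n y) \<partial>lborel)"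
    using lim_imp_Liminf[OF _ Flim] by simp
  also have "\<dots> \<le> liminf (\<lambda>n. \<integral>\<^sup>+y. F n y \<partial>lborel)"
    by (rule nn_integral_liminf[OF Fm])
  also have "\<dots> \<le> ennreal (1 / c)"
    using Liminf_mono[of "\<lambda>n. \<integral>\<^sup>+y. F n y \<partial>lborel" "\<lambda>_. ennreal (1 / c)" sequentially] Fint
    by (simp add: Liminf_const)
  finally show ?thesis .
qed

text \<open>Boundary values of \<open>f\<close> are avoided by the shift
  \<open>\<epsilon> n\<close>, which makes \<open>f\<close> bounded and continuous up to the axis.
  For each shift the Poisson majorant at \<open>\<phi> (Complex x y)\<close> is integrated over
  \<open>y\<close> first, which costs \<open>1 / c\<close>, and then over \<open>t\<close>; Fatou's
  lemma removes the shift.\<close>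

proposition hardy_sup_comp_le:
  assumes f: "f \<in> hardy_space p" and p: "0 < p"
    and \<phi>: "\<phi> holomorphic_on right_half_plane" "\<And>z. 0 < Re z \<Longrightarrow> c * Re z \<le> Re (\<phi> z)"
    and c: "0 < c"
  shows "hardy_sup p (f \<circ> \<phi>) \<le> ennreal (1 / c) * hardy_sup p f"
proof (rule hardy_sup_leI)
  fix x :: real assume x: "0 < x"
  have hol: "f holomorphic_on right_half_plane" using f by (simp add: hardy_space_def)
  define \<epsilon> where "\<epsilon> n = inverse (real (Suc n))" for n
  have \<epsilon>0: "0 < \<epsilon> n" for n by (simp add: \<epsilon>_def)
  define v where "v n t = norm (f (Complex (\<epsilon> n) t)) powr p" for n t
  have \<phi>_pos: "0 < Re (\<phi> z)" if "0 < Re z" for z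
    using \<phi>(2)[OF that] that c by (meson less_le_trans mult_pos_pos)
  have cont_\<phi>: "continuous_on UNIV (\<lambda>y. \<phi> (Complex x y))"
    using x by (intro continuous_on_compose2[OF holomorphic_on_imp_continuous_on[OF \<phi>(1)]])
      (auto simp: Complex_eq intro!: continuous_intros)
  have vm: "v n \<in> borel_measurable borel" for n
    unfolding v_def using \<epsilon>0
    by (intro borel_measurable_powr_norm[OF hol]) (auto simp: Complex_eq intro!: continuous_intros)
  define F where "F n y = ennreal (norm (f (of_real (\<epsilon> n) + \<phi> (Complex x y))) powr p)" for n y
  have Fm: "F n \<in> borel_measurable lborel" for n
  proof -
    have "continuous_on UNIV (\<lambda>y. of_real (\<epsilon> n) + \<phi> (Complex x y))"
      by (intro continuous_intros cont_\<phi>)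
    from borel_measurable_powr_norm[OF hol this, of p] show ?thesis
      unfolding F_def using x \<epsilon>0[of n] by (simp add: add_pos_pos \<phi>_pos)
  qed
  have Fint: "(\<integral>\<^sup>+y. F n y \<partial>lborel) \<le> ennreal (2 * pi) * (ennreal (1 / c) * hardy_sup p f)" for n
  proof -
    obtain B where B: "\<And>z. \<epsilon> n \<le> Re z \<Longrightarrow> norm (f z) \<le> B"
      using hardy_space_bounded[OF f p \<epsilon>0] by blast
    have "(\<lambda>z. f (of_real (\<epsilon> n) + z)) holomorphic_on {z. - \<epsilon> n < Re z}"
      by (intro holomorphic_on_compose_gen[OF _ hol, unfolded o_def] holomorphic_intros) auto
    then have holf: "(\<lambda>z. f (of_real (\<epsilon> n) + z)) holomorphic_on {z. 0 < Re z}"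
      and contf: "continuous_on {z. 0 \<le> Re z} (\<lambda>z. f (of_real (\<epsilon> n) + z))"
      using \<epsilon>0[of n] by (auto elim!: holomorphic_on_subset intro!: holomorphic_on_imp_continuous_on)
    have maj: "F n y \<le> (\<integral>\<^sup>+t. ennreal (poisson_kernel (\<phi> (Complex x y)) t) * ennreal (v n t) \<partial>lborel)" for y
    proof -
      have w: "0 < Re (\<phi> (Complex x y))" using x by (intro \<phi>_pos) simp
      have "F n y \<le> (\<integral>\<^sup>+t. ennreal (poisson_kernel (\<phi> (Complex x y)) t * norm (f (of_real (\<epsilon> n) + \<i> * of_real t)) powr p) \<partial>lborel)"
        unfolding F_def by (rule Poisson_majorant_powr[OF holf contf B w p]) simp
      then show ?thesis
        using poisson_kernel_pos[OF w] by (simp add: v_def Complex_eq ennreal_mult less_imp_le)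
    qed
    have Pm: "(\<lambda>(y, t). poisson_kernel (\<phi> (Complex x y)) t) \<in> borel_measurable (borel \<Otimes>\<^sub>M borel)"
    proof -
      have "continuous_on UNIV (\<lambda>z. poisson_kernel (\<phi> (Complex x (fst z))) (snd z))"
        using x by (intro continuous_on_poisson_kernel continuous_on_compose2[OF cont_\<phi>] \<phi>_pos) (auto intro!: continuous_intros)
      then show ?thesis
        by (simp add: case_prod_unfold borel_prod borel_measurable_continuous_onI)
    qed
    have "(\<integral>\<^sup>+y. F n y \<partial>lborel)
        \<le> (\<integral>\<^sup>+y. (\<integral>\<^sup>+t. ennreal (poisson_kernel (\<phi> (Complex x y)) t) * ennreal (v n t) \<partial>lborel) \<partial>lborel)"
      by (intro nn_integral_mono maj)
    also have "\<dots> = (\<integral>\<^sup>+t. (\<integral>\<^sup>+y. ennreal (poisson_kernel (\<phi> (Complex x y)) t) * ennreal (v n t) \<partial>lborel) \<partial>lborel)"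
    proof (rule lborel_pair.Fubini'[symmetric])
      have "(\<lambda>z. ennreal (poisson_kernel (\<phi> (Complex x (fst z))) (snd z)) * ennreal (v n (snd z))) \<in> borel_measurable (borel \<Otimes>\<^sub>M borel)"
        using Pm vm[of n] by (simp add: case_prod_unfold)
      then show "(\<lambda>(y, t). ennreal (poisson_kernel (\<phi> (Complex x y)) t) * ennreal (v n t)) \<in> borel_measurable (lborel \<Otimes>\<^sub>M lborel)"
        by (simp add: case_prod_unfold cong: measurable_cong_sets)
    qed
    also have "\<dots> = (\<integral>\<^sup>+t. (\<integral>\<^sup>+y. ennreal (poisson_kernel (\<phi> (Complex x y)) t) \<partial>lborel) * ennreal (v n t) \<partial>lborel)"
    proof (intro nn_integral_cong nn_integral_multc)
      fix t
      have "continuous_on UNIV (\<lambda>y. poisson_kernel (\<phi> (Complex x y)) t)"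
        using x by (intro continuous_on_poisson_kernel cont_\<phi> \<phi>_pos continuous_intros) auto
      from borel_measurable_continuous_onI[OF this]
      show "(\<lambda>y. ennreal (poisson_kernel (\<phi> (Complex x y)) t)) \<in> borel_measurable lborel"
        by simp
    qed
    also have "\<dots> \<le> (\<integral>\<^sup>+t. ennreal (1 / c) * ennreal (v n t) \<partial>lborel)"
      by (intro nn_integral_mono mult_right_mono nn_integral_poisson_comp_le[OF \<phi> c x]) auto
    also have "\<dots> = ennreal (1 / c) * (\<integral>\<^sup>+t. ennreal (v n t) \<partial>lborel)"
      using vm[of n] by (intro nn_integral_cmult) simp
    also have "\<dots> \<le> ennreal (1 / c) * (ennreal (2 * pi) * hardy_sup p f)"
      unfolding v_def by (intro mult_left_mono hardy_sup_line_le \<epsilon>0) simp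
    finally show ?thesis by (simp add: mult_ac)
  qed
  have Flim: "(\<lambda>n. F n y) \<longlonglongrightarrow> ennreal (norm ((f \<circ> \<phi>) (Complex x y)) powr p)" for y
  proof -
    have w: "0 < Re (\<phi> (Complex x y))" using x by (intro \<phi>_pos) simp
    have "(\<lambda>n. of_real (\<epsilon> n) + \<phi> (Complex x y)) \<longlonglongrightarrow> of_real 0 + \<phi> (Complex x y)"
      unfolding \<epsilon>_def by (intro tendsto_intros LIMSEQ_inverse_real_of_nat)
    then have "(\<lambda>n. f (of_real (\<epsilon> n) + \<phi> (Complex x y))) \<longlonglongrightarrow> f (\<phi> (Complex x y))"
      using w \<epsilon>0
      by (intro continuous_on_tendsto_compose[OF holomorphic_on_imp_continuous_on[OF hol]])
         (auto intro!: always_eventually add_pos_pos)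
    then show ?thesis
      unfolding F_def o_def using p by (intro tendsto_ennrealI tendsto_powr' tendsto_norm tendsto_const) auto
  qed
  have "(\<integral>\<^sup>+y. ennreal (norm ((f \<circ> \<phi>) (Complex x y)) powr p) \<partial>lborel) = (\<integral>\<^sup>+y. liminf (\<lambda>n. F n y) \<partial>lborel)"
    using lim_imp_Liminf[OF _ Flim] by simp
  also have "\<dots> \<le> liminf (\<lambda>n. \<integral>\<^sup>+y. F n y \<partial>lborel)"
    by (rule nn_integral_liminf[OF Fm])
  also have "\<dots> \<le> ennreal (2 * pi) * (ennreal (1 / c) * hardy_sup p f)"
    using Liminf_mono[of "\<lambda>n. \<integral>\<^sup>+y. F n y \<partial>lborel" "\<lambda>_. ennreal (2 * pi) * (ennreal (1 / c) * hardy_sup p f)" sequentially] Fint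
    by (simp add: Liminf_const)
  finally show "(\<integral>\<^sup>+y. ennreal (norm ((f \<circ> \<phi>) (Complex x y)) powr p) \<partial>lborel)
      \<le> ennreal (2 * pi) * (ennreal (1 / c) * hardy_sup p f)" .
qed

section \<open>Point evaluations and the lower bound\<close>

lemma norm_powr_of_real_exponent:
  "z \<noteq> 0 \<Longrightarrow> norm ((z :: complex) powr of_real a) = norm z powr a"
  by (simp add: powr_def norm_exp_eq_Re)

text \<open>This form exhibits the squared modulus that a weight \<open>z + cnj w\<close> can cancel
  on the axis.\<close>

lemma poisson_kernel_eq_norm:
  "poisson_kernel w t = Re w / (pi * (norm (\<i> * of_real t + cnj w))\<^sup>2)"
  by (simp add: poisson_kernel_def cmod_power2)

text \<open>Multiplying \<open>f\<close> by a damped power of \<open>z + cnj w\<close> cancels the Poisson kernel at \<open>w\<close>. Estimating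
  the kernel by its maximum instead would lose a factor 4, and with it the exact norm of \<open>C\<^sub>\<phi>\<close>.\<close>

proposition hardy_point_evaluation:
  assumes f: "f \<in> hardy_space p" and p: "0 < p" and w: "0 < Re w"
  shows "ennreal (norm (f w) powr p * (2 * Re w)) \<le> hardy_sup p f"
proof -
  have hol: "f holomorphic_on right_half_plane" and fin: "hardy_sup p f < \<infinity>"
    using f by (auto simp: hardy_space_def)
  define S where "S = enn2real (hardy_sup p f)"
  have S: "hardy_sup p f = ennreal S" and S0: "0 \<le> S"
    using fin by (auto simp: S_def)
  define \<epsilon> where "\<epsilon> n = inverse (real (Suc n))" for n
  have \<epsilon>0: "0 < \<epsilon> n" for n by (simp add: \<epsilon>_def)
  \<comment> \<open>The squared quotient is the value of the weight at \<open>w\<close>, since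
    \<open>w + cnj w = 2 * Re w\<close>. One factor \<open>2 * Re w\<close> cancels after the
    limit.\<close>
  have le: "norm (f (of_real (\<epsilon> n) + w)) powr p * ((2 * Re w) / norm (1 + of_real (\<epsilon> n) * w))\<^sup>2 \<le> 2 * Re w * S" for n
  proof -
    let ?e = "of_real (\<epsilon> n) :: complex"
    obtain B where B: "\<And>z. \<epsilon> n \<le> Re z \<Longrightarrow> norm (f z) \<le> B"
      using hardy_space_bounded[OF f p \<epsilon>0] by blast
    have B0: "0 \<le> B" using B[of ?e] norm_ge_zero[of "f ?e"] by (simp del: norm_ge_zero)
    \<comment> \<open>The exponent \<open>2 / p\<close> makes the weight a squared modulus once the
      power \<open>p\<close> is taken. The denominator keeps the weight bounded and tends to 1 with
      vanishing \<open>\<epsilon> n\<close>.\<close>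
    define h where "h z = f (?e + z) * ((z + cnj w) powr of_real (2 / p) / (1 + ?e * z) powr of_real (2 / p))" for z
    have "(\<lambda>z. f (?e + z)) holomorphic_on {z. - \<epsilon> n < Re z}"
      by (intro holomorphic_on_compose_gen[OF _ hol, unfolded o_def] holomorphic_intros) auto
    then have holf: "(\<lambda>z. f (?e + z)) holomorphic_on {z. 0 < Re z}"
      and contf: "continuous_on {z. 0 \<le> Re z} (\<lambda>z. f (?e + z))"
      using \<epsilon>0[of n] by (auto elim!: holomorphic_on_subset intro!: holomorphic_on_imp_continuous_on)
    have Re1: "1 \<le> Re (1 + ?e * z)" if "0 \<le> Re z" for z
      using that \<epsilon>0[of n] by simp
    have slit: "z + cnj w \<notin> \<real>\<^sub>\<le>\<^sub>0" "1 + ?e * z \<notin> \<real>\<^sub>\<le>\<^sub>0" if "0 \<le> Re z" for z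
    proof -
      have "0 < Re (z + cnj w)" "0 < Re (1 + ?e * z)"
        using that w Re1[OF that] by simp_all
      then show "z + cnj w \<notin> \<real>\<^sub>\<le>\<^sub>0" "1 + ?e * z \<notin> \<real>\<^sub>\<le>\<^sub>0"
        unfolding complex_nonpos_Reals_iff by linarith+
    qed
    have nz: "z + cnj w \<noteq> 0" "1 + ?e * z \<noteq> 0" if "0 \<le> Re z" for z
      using slit[OF that] by auto
    have nzp: "(1 + ?e * z) powr of_real (2 / p) \<noteq> 0" if "0 \<le> Re z" for z
      using nz(2)[OF that] by simp
    have holh: "h holomorphic_on {z. 0 < Re z}"
      unfolding h_def by (intro holomorphic_intros holf slit nzp) auto
    have conth: "continuous_on {z. 0 \<le> Re z} h"
      unfolding h_def by (intro continuous_intros contf nzp)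
      (auto simp: p less_imp_le[OF w] less_imp_le[OF \<epsilon>0] dest: nz)
    have nh: "norm (h z) powr p = norm (f (?e + z)) powr p * ((norm (z + cnj w) / norm (1 + ?e * z)))\<^sup>2"
      if "0 \<le> Re z" for z
    proof -
      have "norm (h z) powr p = norm (f (?e + z)) powr p *
          (((norm (z + cnj w)) powr (2 / p)) powr p / ((norm (1 + ?e * z)) powr (2 / p)) powr p)"
        using nz[OF that] by (simp add: h_def norm_mult norm_divide norm_powr_of_real_exponent powr_mult powr_divide del: of_real_divide)
      also have "((norm (z + cnj w)) powr (2 / p)) powr p = (norm (z + cnj w))\<^sup>2"
        using p nz[OF that] by (simp add: powr_powr)
      also have "((norm (1 + ?e * z)) powr (2 / p)) powr p = (norm (1 + ?e * z))\<^sup>2"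
        using p nz[OF that] by (simp add: powr_powr)
      finally show ?thesis by (simp add: power_divide)
    qed
    have bdd: "norm (h z) \<le> B * (1 / \<epsilon> n + norm w) powr (2 / p)" if "0 \<le> Re z" for z
    proof -
      have n1: "1 \<le> norm (1 + ?e * z)"
        using Re1[OF that] complex_Re_le_cmod order_trans by blast
      \<comment> \<open>As \<open>Re z\<close> is nonnegative, adding 1 can only increase the
        modulus.\<close>
      have "norm (?e * z) \<le> norm (1 + ?e * z)"
        unfolding cmod_def using that \<epsilon>0[of n] by (auto intro!: real_sqrt_le_mono add_mono power_mono)
      then have "norm z \<le> 1 / \<epsilon> n * norm (1 + ?e * z)"
        using \<epsilon>0[of n] by (simp add: norm_mult field_simps)
      moreover have "norm w * 1 \<le> norm w * norm (1 + ?e * z)"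
        using n1 by (intro mult_left_mono) auto
      ultimately have "norm (z + cnj w) \<le> (1 / \<epsilon> n + norm w) * norm (1 + ?e * z)"
        using norm_triangle_ineq[of z "cnj w"] by (simp add: distrib_right)
      then have "norm (z + cnj w) / norm (1 + ?e * z) \<le> 1 / \<epsilon> n + norm w"
        using n1 by (subst pos_divide_le_eq) auto
      then have "(norm (z + cnj w) / norm (1 + ?e * z)) powr (2 / p) \<le> (1 / \<epsilon> n + norm w) powr (2 / p)"
        using p by (intro powr_mono2) auto
      moreover have "norm (f (?e + z)) \<le> B" using that by (intro B) simp
      ultimately show ?thesis
        unfolding h_def norm_mult norm_divide norm_powr_of_real_exponent[OF nz(1)[OF that]]
          norm_powr_of_real_exponent[OF nz(2)[OF that]]
        using B0 by (intro mult_mono) (simp_all add: powr_divide)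
    qed
    have "ennreal (norm (h w) powr p)
        \<le> (\<integral>\<^sup>+t. ennreal (poisson_kernel w t * norm (h (\<i> * of_real t)) powr p) \<partial>lborel)"
      by (rule Poisson_majorant_powr[OF holh conth bdd w p])
    \<comment> \<open>On the axis the weight turns the kernel into the constant
      \<open>Re w / pi\<close>; the damping denominator has modulus at least 1 and is
      dropped.\<close>
    also have "\<dots> \<le> (\<integral>\<^sup>+t. ennreal (Re w / pi) * ennreal (norm (f (Complex (\<epsilon> n) t)) powr p) \<partial>lborel)"
    proof (intro nn_integral_mono)
      fix t :: real
      let ?z = "\<i> * of_real t"
      have z: "0 \<le> Re ?z" by simp
      have n1: "1 \<le> norm (1 + ?e * ?z)"
        using Re1[OF z] complex_Re_le_cmod order_trans by blast
      have n0: "0 < norm (?z + cnj w)" using nz(1)[OF z] by simp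
      have "poisson_kernel w t * norm (h ?z) powr p
          = (Re w / pi * norm (f (?e + ?z)) powr p) / (norm (1 + ?e * ?z))\<^sup>2"
        unfolding nh[OF z] poisson_kernel_eq_norm using n0 by (simp add: power_divide)
      also have "\<dots> \<le> (Re w / pi * norm (f (?e + ?z)) powr p) / 1"
        using n1 w by (intro divide_left_mono) (auto intro: one_le_power)
      also have "?e + ?z = Complex (\<epsilon> n) t" by (simp add: Complex_eq)
      finally show "ennreal (poisson_kernel w t * norm (h ?z) powr p)
          \<le> ennreal (Re w / pi) * ennreal (norm (f (Complex (\<epsilon> n) t)) powr p)"
        using w by (simp add: ennreal_mult[symmetric] ennreal_leI)
    qed
    also have "\<dots> = ennreal (Re w / pi) * (\<integral>\<^sup>+t. ennreal (norm (f (Complex (\<epsilon> n) t)) powr p) \<partial>lborel)"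
    proof (rule nn_integral_cmult)
      have "(\<lambda>t. norm (f (Complex (\<epsilon> n) t)) powr p) \<in> borel_measurable borel"
        using \<epsilon>0 by (intro borel_measurable_powr_norm[OF hol]) (auto simp: Complex_eq intro!: continuous_intros)
      then show "(\<lambda>t. ennreal (norm (f (Complex (\<epsilon> n) t)) powr p)) \<in> borel_measurable lborel" by simp
    qed
    also have "\<dots> \<le> ennreal (Re w / pi) * (ennreal (2 * pi) * hardy_sup p f)"
      by (intro mult_left_mono hardy_sup_line_le \<epsilon>0) simp
    also have "\<dots> = ennreal (2 * Re w * S)"
      using w S0 by (simp add: S ennreal_mult[symmetric])
    finally have "norm (h w) powr p \<le> 2 * Re w * S"
      using w S0 by simp
    moreover have "norm (w + cnj w) = 2 * Re w"
      using w by (simp add: complex_add_cnj)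
    ultimately show ?thesis
      using nh[of w] w by simp
  qed
  have "(\<lambda>n. norm (f (of_real (\<epsilon> n) + w)) powr p * ((2 * Re w) / norm (1 + of_real (\<epsilon> n) * w))\<^sup>2)
      \<longlonglongrightarrow> norm (f w) powr p * ((2 * Re w) / norm (1 + of_real 0 * w))\<^sup>2"
  proof -
    have \<epsilon>: "\<epsilon> \<longlonglongrightarrow> 0" unfolding \<epsilon>_def by (rule LIMSEQ_inverse_real_of_nat)
    have "(\<lambda>n. of_real (\<epsilon> n) + w) \<longlonglongrightarrow> of_real 0 + w"
      by (intro tendsto_intros \<epsilon>)
    then have "(\<lambda>n. f (of_real (\<epsilon> n) + w)) \<longlonglongrightarrow> f w"
      using w \<epsilon>0
      by (intro continuous_on_tendsto_compose[OF holomorphic_on_imp_continuous_on[OF hol]])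
         (auto intro!: always_eventually add_pos_pos)
    then have 1: "(\<lambda>n. norm (f (of_real (\<epsilon> n) + w)) powr p) \<longlonglongrightarrow> norm (f w) powr p"
      using p by (intro tendsto_powr' tendsto_norm tendsto_const) auto
    show ?thesis by (intro tendsto_intros 1 \<epsilon>) auto
  qed
  then have "norm (f w) powr p * (2 * Re w)\<^sup>2 \<le> 2 * Re w * S"
    using LIMSEQ_le_const2 le by fastforce
  then have "norm (f w) powr p * (2 * Re w) \<le> S"
    using w by (simp add: power2_eq_square mult_ac)
  then show ?thesis unfolding S by (rule ennreal_leI)
qed

lemma nn_integral_poisson_kernel:
  assumes "0 < Re w"
  shows "(\<integral>\<^sup>+t. ennreal (poisson_kernel w t) \<partial>lborel) = 1"
  using Poisson_Re[of "\<lambda>_. 1" 1 w] assms by simp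

text \<open>The test functions are \<open>p\<close>-th roots of normalised squared reproducing kernels of \<open>H\<^sup>2\<close>.\<close>

lemma hardy_test_function:
  assumes p: "0 < p" and a: "0 < Re a"
  obtains k where "k \<in> hardy_space p" "hardy_sup p k \<le> 1" "norm (k a) powr p = 1 / (2 * Re a)"
proof -
  define k where "k z = of_real ((2 * Re a) powr (1 / p)) * (z + cnj a) powr of_real (- (2 / p))" for z
  have nz: "z + cnj a \<notin> \<real>\<^sub>\<le>\<^sub>0" "z + cnj a \<noteq> 0" if "0 < Re z" for z
    using that a by (auto simp: complex_nonpos_Reals_iff complex_eq_iff)
  have nk: "norm (k z) powr p = 2 * Re a / (norm (z + cnj a))\<^sup>2" if "0 < Re z" for z
  proof -
    have n0: "0 < norm (z + cnj a)" using nz[OF that] by simp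
    have "norm (k z) = (2 * Re a) powr (1 / p) * norm (z + cnj a) powr - (2 / p)"
      unfolding k_def norm_mult norm_powr_of_real_exponent[OF nz(2)[OF that]] by simp
    then have "norm (k z) powr p = 2 * Re a * norm (z + cnj a) powr - 2"
      using a p by (simp add: powr_mult powr_powr)
    then show ?thesis using n0 by (simp add: powr_minus divide_inverse)
  qed
  have hol: "k holomorphic_on right_half_plane"
    unfolding k_def using nz by (intro holomorphic_intros) auto
  have le1: "hardy_sup p k \<le> 1"
  proof (rule hardy_sup_leI)
    fix x :: real assume x: "0 < x"
    have w: "0 < Re (of_real x + a)" using x a by simp
    \<comment> \<open>On this line the left side is \<open>2 * pi\<close> times the kernel for the
      base point \<open>x + a\<close>, except that its numerator has \<open>Re a\<close> in place of
      the larger \<open>x + Re a\<close>. The kernel has mass 1, whence the bound 1 on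
      \<open>hardy_sup\<close>.\<close>
    have "norm (k (Complex x y)) powr p \<le> 2 * pi * poisson_kernel (of_real x + a) y" for y
    proof -
      have eq: "Complex x y + cnj a = \<i> * of_real y + cnj (of_real x + a)"
        by (simp add: complex_eq_iff)
      have "norm (k (Complex x y)) powr p = 2 * Re a / (norm (\<i> * of_real y + cnj (of_real x + a)))\<^sup>2"
        using nk[of "Complex x y"] x unfolding eq by (simp only: complex.sel)
      also have "\<dots> \<le> 2 * (Re (of_real x + a)) / (norm (\<i> * of_real y + cnj (of_real x + a)))\<^sup>2"
        using x by (intro divide_right_mono) auto
      finally show ?thesis
        unfolding poisson_kernel_eq_norm by simp
    qed
    then have "(\<integral>\<^sup>+y. ennreal (norm (k (Complex x y)) powr p) \<partial>lborel)
        \<le> (\<integral>\<^sup>+y. ennreal (2 * pi) * ennreal (poisson_kernel (of_real x + a) y) \<partial>lborel)"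
      using poisson_kernel_pos[OF w]
      by (intro nn_integral_mono) (simp add: ennreal_mult[symmetric] less_imp_le ennreal_leI)
    also have "\<dots> = ennreal (2 * pi) * 1"
    proof (subst nn_integral_cmult)
      have "(\<lambda>y. poisson_kernel (of_real x + a) y) \<in> borel_measurable borel"
        using borel_measurable_poisson_mult[OF w, of "\<lambda>_. 1"] by simp
      then show "(\<lambda>y. ennreal (poisson_kernel (of_real x + a) y)) \<in> borel_measurable lborel" by simp
    qed (simp only: nn_integral_poisson_kernel[OF w])
    finally show "(\<integral>\<^sup>+y. ennreal (norm (k (Complex x y)) powr p) \<partial>lborel) \<le> ennreal (2 * pi) * 1" .
  qed
  show ?thesis
  proof
    show "k \<in> hardy_space p"
      using hol le1 by (auto simp: hardy_space_def intro: le_less_trans)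
    show "norm (k a) powr p = 1 / (2 * Re a)"
      using nk[OF a] a by (simp add: complex_add_cnj power2_eq_square)
  qed (rule le1)
qed

section \<open>From the supremum to the norm, and the two operator bounds\<close>

lemma hardy_norm_nonneg: "0 \<le> hardy_norm p f"
  by (simp add: hardy_norm_def)

lemma hardy_norm_powr:
  assumes "f \<in> hardy_space p" "0 < p"
  shows "ennreal (hardy_norm p f powr p) = hardy_sup p f"
proof -
  have "hardy_norm p f powr p = enn2real (hardy_sup p f)"
    using assms(2) by (simp add: hardy_norm_def powr_powr)
  then show ?thesis using assms(1) by (simp add: hardy_space_def less_top)
qed

lemma hardy_norm_le_iff:
  assumes "f \<in> hardy_space p" "0 < p" "0 \<le> N"
  shows "hardy_norm p f \<le> N \<longleftrightarrow> hardy_sup p f \<le> ennreal (N powr p)"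
proof -
  have "hardy_norm p f \<le> N \<longleftrightarrow> hardy_norm p f powr p \<le> N powr p"
    using powr_mono2[of p "hardy_norm p f" N] powr_less_mono2[of p N "hardy_norm p f"]
      assms(2,3) hardy_norm_nonneg[of p f] by linarith
  then show ?thesis
    unfolding hardy_norm_powr[OF assms(1,2), symmetric] by simp
qed

lemma zero_in_hardy_unit_ball: "0 < p \<Longrightarrow> (\<lambda>_. 0) \<in> hardy_unit_ball p"
  by (simp add: hardy_unit_ball_def hardy_space_def hardy_sup_def hardy_norm_def)

text \<open>The factor 2 in the point evaluation cancels against the one in the extremal function at
  \<open>\<phi> w\<close>, so the comparison has no extra constant. Kept in product form, it can
  also rule out operator norm 0.\<close>

lemma comp_op_bounded_Re_le:
  assumes p: "0 < p" and \<phi>: "\<phi> ` right_half_plane \<subseteq> right_half_plane"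
    and bounded: "comp_op_bounded p \<phi>" and w: "0 < Re w"
  shows "Re w \<le> comp_op_norm p \<phi> powr p * Re (\<phi> w)" "0 \<le> comp_op_norm p \<phi>"
proof -
  have bdd: "bdd_above ((\<lambda>f. hardy_norm p (f \<circ> \<phi>)) ` hardy_unit_ball p)"
    using bounded by (simp add: comp_op_bounded_def)
  have le: "hardy_norm p (f \<circ> \<phi>) \<le> comp_op_norm p \<phi>" if "f \<in> hardy_unit_ball p" for f
    unfolding comp_op_norm_def using bdd that by (intro cSUP_upper)
  show N0: "0 \<le> comp_op_norm p \<phi>"
    using le[OF zero_in_hardy_unit_ball[OF p]] hardy_norm_nonneg order_trans by blast
  have a: "0 < Re (\<phi> w)" using \<phi> w by (simp add: image_subset_iff)
  obtain k where k: "k \<in> hardy_space p" "hardy_sup p k \<le> 1" "norm (k (\<phi> w)) powr p = 1 / (2 * Re (\<phi> w))"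
    using hardy_test_function[OF p a] by blast
  have "k \<in> hardy_unit_ball p"
    using k(1,2) hardy_norm_le_iff[OF k(1) p, of 1] by (simp add: hardy_unit_ball_def)
  moreover have kp: "k \<circ> \<phi> \<in> hardy_space p"
    using bounded k(1) by (simp add: comp_op_bounded_def)
  ultimately have "hardy_sup p (k \<circ> \<phi>) \<le> ennreal (comp_op_norm p \<phi> powr p)"
    using hardy_norm_le_iff[OF kp p N0] le by blast
  then have "ennreal (norm ((k \<circ> \<phi>) w) powr p * (2 * Re w)) \<le> ennreal (comp_op_norm p \<phi> powr p)"
    using hardy_point_evaluation[OF kp p w] order_trans by blast
  then have "Re w / Re (\<phi> w) \<le> comp_op_norm p \<phi> powr p"
    using k(3) by simp
  then show "Re w \<le> comp_op_norm p \<phi> powr p * Re (\<phi> w)"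
    using a by (simp add: pos_divide_le_eq)
qed

lemma comp_op_boundedI:
  assumes p: "0 < p" and hol: "\<phi> holomorphic_on right_half_plane"
    and \<phi>: "\<phi> ` right_half_plane \<subseteq> right_half_plane"
    and c: "0 < c" "\<And>z. 0 < Re z \<Longrightarrow> c * Re z \<le> Re (\<phi> z)"
  shows "comp_op_bounded p \<phi>" "comp_op_norm p \<phi> \<le> (1 / c) powr (1 / p)"
proof -
  have space: "f \<circ> \<phi> \<in> hardy_space p" if f: "f \<in> hardy_space p" for f
  proof -
    have "f \<circ> \<phi> holomorphic_on right_half_plane"
      using f holomorphic_on_compose_gen[OF hol _ \<phi>, of f] by (simp add: hardy_space_def)
    moreover have "hardy_sup p (f \<circ> \<phi>) < \<infinity>"
      using hardy_sup_comp_le[OF f p hol c(2,1)] f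
      by (auto simp: hardy_space_def ennreal_mult_less_top intro: le_less_trans)
    ultimately show ?thesis by (simp add: hardy_space_def)
  qed
  have le: "hardy_norm p (f \<circ> \<phi>) \<le> (1 / c) powr (1 / p)" if f: "f \<in> hardy_unit_ball p" for f
  proof -
    have f': "f \<in> hardy_space p" "hardy_sup p f \<le> 1"
      using f hardy_norm_le_iff[of f p 1] p by (auto simp: hardy_unit_ball_def)
    have "hardy_sup p (f \<circ> \<phi>) \<le> ennreal (1 / c) * hardy_sup p f"
      by (rule hardy_sup_comp_le[OF f'(1) p hol c(2,1)])
    also have "\<dots> \<le> ennreal (1 / c) * 1"
      using f'(2) by (rule mult_left_mono) simp
    finally show ?thesis
      using c p by (subst hardy_norm_le_iff[OF space[OF f'(1)] p]) (auto simp: powr_powr)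
  qed
  show "comp_op_bounded p \<phi>"
    using space le by (auto simp: comp_op_bounded_def intro!: bdd_aboveI2)
  show "comp_op_norm p \<phi> \<le> (1 / c) powr (1 / p)"
    unfolding comp_op_norm_def using zero_in_hardy_unit_ball[OF p] le by (intro cSUP_least) auto
qed

section \<open>The angular derivative at infinity\<close>

text \<open>Schwarz's lemma in the disc coordinates \<open>(u - v) / (u + cnj v)\<close> centred at
  \<open>w\<close> and at \<open>\<psi> w\<close>. Substituting
  \<open>norm (u - v)^2 = norm (u + cnj v)^2 - 4 * Re u * Re v\<close> gives a product form that
  stays meaningful when real parts of \<open>\<psi>\<close> tend to 0.\<close>

lemma Schwarz_Pick_half_plane:
  assumes hol: "\<psi> holomorphic_on right_half_plane" and pos: "\<And>z. 0 < Re z \<Longrightarrow> 0 < Re (\<psi> z)"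
    and z: "0 < Re z" and w: "0 < Re w"
  shows "Re z * Re w * (norm (\<psi> z + cnj (\<psi> w)))\<^sup>2 \<le> Re (\<psi> z) * Re (\<psi> w) * (norm (z + cnj w))\<^sup>2"
proof -
  have sq: "(norm (u + cnj v))\<^sup>2 - (norm (u - v))\<^sup>2 = 4 * (Re u * Re v)" for u v :: complex
    unfolding cmod_power2 by (simp add: algebra_simps power2_eq_square)
  have nz: "u + cnj v \<noteq> 0" if "0 < Re u" "0 < Re v" for u v :: complex
    using that by (auto simp: complex_eq_iff)
  have less: "norm (u - v) < norm (u + cnj v)" if "0 < Re u" "0 < Re v" for u v :: complex
  proof (rule power2_less_imp_less)
    show "(norm (u - v))\<^sup>2 < (norm (u + cnj v))\<^sup>2"
      using sq[of u v] mult_pos_pos[OF that] by linarith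
  qed simp
  define h where "h \<zeta> = (\<psi> (half_plane_map w \<zeta>) - \<psi> w) / (\<psi> (half_plane_map w \<zeta>) + cnj (\<psi> w))" for \<zeta>
  have P: "0 < Re (\<psi> (half_plane_map w \<zeta>))" if "norm \<zeta> < 1" for \<zeta>
    using Re_half_plane_map_pos[OF w that] by (rule pos)
  have "(\<lambda>\<zeta>. \<psi> (half_plane_map w \<zeta>)) holomorphic_on ball 0 1"
    using hol w by (intro holomorphic_on_half_plane_map_comp) (auto simp: right_half_plane_def)
  then have "h holomorphic_on ball 0 1"
    unfolding h_def using nz[OF P pos[OF w]] by (intro holomorphic_intros) auto
  moreover have "h 0 = 0" by (simp add: h_def)
  moreover have "norm (h \<zeta>) < 1" if "norm \<zeta> < 1" for \<zeta>
    using less[OF P[OF that] pos[OF w]] nz[OF P[OF that] pos[OF w]]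
    by (simp add: h_def norm_divide)
  moreover have \<zeta>: "norm ((z - w) / (z + cnj w)) < 1"
    using less[OF z w] nz[OF z w] by (simp add: norm_divide)
  ultimately have "norm (h ((z - w) / (z + cnj w))) \<le> norm ((z - w) / (z + cnj w))"
    by (rule Schwarz_Lemma(1))
  moreover have "half_plane_map w ((z - w) / (z + cnj w)) = z"
  proof -
    have n: "z + cnj w \<noteq> 0" "w + cnj w \<noteq> 0" using nz[OF z w] nz[OF w w] by auto
    have "w + cnj w * ((z - w) / (z + cnj w)) = z * (w + cnj w) / (z + cnj w)"
      "1 - (z - w) / (z + cnj w) = (w + cnj w) / (z + cnj w)"
      using n(1) by (simp_all add: field_simps)
    then show ?thesis unfolding half_plane_map_def using n by simp
  qed
  ultimately have "norm (\<psi> z - \<psi> w) / norm (\<psi> z + cnj (\<psi> w)) \<le> norm (z - w) / norm (z + cnj w)"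
    by (simp add: h_def norm_divide)
  moreover have "0 < norm (\<psi> z + cnj (\<psi> w))" "0 < norm (z + cnj w)"
    using nz[OF z w] nz[OF pos[OF z] pos[OF w]] by auto
  ultimately have "norm (\<psi> z - \<psi> w) * norm (z + cnj w) \<le> norm (z - w) * norm (\<psi> z + cnj (\<psi> w))"
    by (simp add: field_simps)
  then have "(norm (\<psi> z - \<psi> w) * norm (z + cnj w))\<^sup>2 \<le> (norm (z - w) * norm (\<psi> z + cnj (\<psi> w)))\<^sup>2"
    by (rule power_mono) simp
  moreover have "(norm (\<psi> z - \<psi> w))\<^sup>2 = (norm (\<psi> z + cnj (\<psi> w)))\<^sup>2 - 4 * (Re (\<psi> z) * Re (\<psi> w))"
    "(norm (z - w))\<^sup>2 = (norm (z + cnj w))\<^sup>2 - 4 * (Re z * Re w)"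
    using sq[of "\<psi> z" "\<psi> w"] sq[of z w] by auto
  ultimately show ?thesis
    by (simp add: power_mult_distrib algebra_simps)
qed

text \<open>Covers \<open>\<phi> z - c * z\<close>, whose real part can vanish, for instance when
  \<phi> is multiplication by \<open>c\<close>. Adding a small positive constant restores strict
  positivity, and the product form passes to the limit.\<close>

lemma Schwarz_Pick_half_plane_nonneg:
  assumes hol: "\<psi> holomorphic_on right_half_plane" and nonneg: "\<And>z. 0 < Re z \<Longrightarrow> 0 \<le> Re (\<psi> z)"
    and z: "0 < Re z" and w: "0 < Re w"
  shows "Re z * Re w * (norm (\<psi> z + cnj (\<psi> w)))\<^sup>2 \<le> Re (\<psi> z) * Re (\<psi> w) * (norm (z + cnj w))\<^sup>2"
proof (rule tendsto_le[OF sequentially_bot])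
  define \<epsilon> where "\<epsilon> n = inverse (real (Suc n))" for n
  have \<epsilon>0: "0 < \<epsilon> n" for n by (simp add: \<epsilon>_def)
  have \<epsilon>: "\<epsilon> \<longlonglongrightarrow> 0" unfolding \<epsilon>_def by (rule LIMSEQ_inverse_real_of_nat)
  have "(\<lambda>n. Re z * Re w * (norm ((\<psi> z + of_real (\<epsilon> n)) + cnj (\<psi> w + of_real (\<epsilon> n))))\<^sup>2)
      \<longlonglongrightarrow> Re z * Re w * (norm ((\<psi> z + of_real 0) + cnj (\<psi> w + of_real 0)))\<^sup>2"
    by (intro tendsto_intros \<epsilon>)
  then show "(\<lambda>n. Re z * Re w * (norm ((\<psi> z + of_real (\<epsilon> n)) + cnj (\<psi> w + of_real (\<epsilon> n))))\<^sup>2)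
      \<longlonglongrightarrow> Re z * Re w * (norm (\<psi> z + cnj (\<psi> w)))\<^sup>2" by simp
  have "(\<lambda>n. Re (\<psi> z + of_real (\<epsilon> n)) * Re (\<psi> w + of_real (\<epsilon> n)) * (norm (z + cnj w))\<^sup>2)
      \<longlonglongrightarrow> Re (\<psi> z + of_real 0) * Re (\<psi> w + of_real 0) * (norm (z + cnj w))\<^sup>2"
    by (intro tendsto_intros \<epsilon>)
  then show "(\<lambda>n. Re (\<psi> z + of_real (\<epsilon> n)) * Re (\<psi> w + of_real (\<epsilon> n)) * (norm (z + cnj w))\<^sup>2)
      \<longlonglongrightarrow> Re (\<psi> z) * Re (\<psi> w) * (norm (z + cnj w))\<^sup>2" by simp
  show "\<forall>\<^sub>F n in sequentially. Re z * Re w * (norm ((\<psi> z + of_real (\<epsilon> n)) + cnj (\<psi> w + of_real (\<epsilon> n))))\<^sup>2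
      \<le> Re (\<psi> z + of_real (\<epsilon> n)) * Re (\<psi> w + of_real (\<epsilon> n)) * (norm (z + cnj w))\<^sup>2"
    using \<epsilon>0 nonneg
    by (intro always_eventually allI Schwarz_Pick_half_plane[OF _ _ z w] holomorphic_intros hol)
       (auto intro: add_nonneg_pos)
qed

text \<open>The Julia--Caratheodory theorem at infinity: \<open>c\<close> is the largest constant with
  \<open>c * Re z \<le> Re (\<phi> z)\<close>, so \<open>\<psi> z = \<phi> z - c * z\<close> has nonnegative real part, and \<open>Re (\<psi> w) / Re w\<close> can be
  made small at a base point \<open>w\<close> for the Schwarz--Pick inequality.\<close>

lemma Julia_Caratheodory_infinity:
  assumes hol: "\<phi> holomorphic_on right_half_plane"
    and le: "\<And>z. 0 < Re z \<Longrightarrow> c * Re z \<le> Re (\<phi> z)"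
    and inf: "\<And>e. c < e \<Longrightarrow> \<exists>w. 0 < Re w \<and> Re (\<phi> w) < e * Re w"
    and nt: "nontangential_to_infinity z"
  shows "(\<lambda>n. \<phi> (z n) / z n) \<longlonglongrightarrow> of_real c"
proof -
  obtain M where M: "\<And>n. \<bar>Im (z n)\<bar> / Re (z n) \<le> M" and zpos: "\<And>n. 0 < Re (z n)"
    and lim: "filterlim (\<lambda>n. Re (z n)) at_top sequentially"
    using nt unfolding nontangential_to_infinity_def by auto
  have M0: "0 \<le> M" using M[of 0] zpos[of 0] by (meson abs_ge_zero divide_nonneg_pos order_trans)
  define \<psi> where "\<psi> w = \<phi> w - of_real c * w" for w
  have hol\<psi>: "\<psi> holomorphic_on right_half_plane"
    unfolding \<psi>_def by (intro holomorphic_intros hol)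
  have nonneg: "0 \<le> Re (\<psi> w)" if "0 < Re w" for w
    using le[OF that] by (simp add: \<psi>_def)
  \<comment> \<open>Non-tangential approach keeps the sequence in a sector, where modulus and real
    part are comparable.\<close>
  have sector: "norm (z n) \<le> (1 + M) * Re (z n)" for n
  proof -
    have "norm (z n) \<le> Re (z n) + \<bar>Im (z n)\<bar>" using cmod_le[of "z n"] zpos[of n] by simp
    moreover have "\<bar>Im (z n)\<bar> \<le> M * Re (z n)"
      using M[of n] zpos[of n] by (simp add: pos_divide_le_eq)
    ultimately show ?thesis by (simp add: distrib_right)
  qed
  have norm_inf: "filterlim z at_infinity sequentially"
    unfolding filterlim_at_infinity_conv_norm_at_top
    by (rule filterlim_at_top_mono[OF lim]) (auto intro: complex_Re_le_cmod always_eventually)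
  have "(\<lambda>n. \<psi> (z n) / z n) \<longlonglongrightarrow> 0"
  proof (rule LIMSEQ_I)
    fix r :: real assume r: "0 < r"
    \<comment> \<open>Chosen so that the estimate below tends to \<open>r / 4\<close>, which is less
      than \<open>r\<close>.\<close>
    define \<delta> where "\<delta> = r / (4 * (1 + M))"
    have \<delta>: "0 < \<delta>" using r M0 by (simp add: \<delta>_def)
    then obtain w where w: "0 < Re w" "Re (\<phi> w) < (c + \<delta>) * Re w"
      using inf[of "c + \<delta>"] by auto
    then have \<psi>w: "Re (\<psi> w) \<le> \<delta> * Re w" by (simp add: \<psi>_def algebra_simps)
    have est: "norm (\<psi> (z n) / z n) \<le> \<delta> * (1 + M) * (norm (z n + cnj w) / norm (z n))\<^sup>2 + norm (\<psi> w) / norm (z n)" for n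
    proof -
      define A where "A = norm (\<psi> (z n) + cnj (\<psi> w))"
      have zn: "0 < norm (z n)" using zpos[of n] by auto
      have "Re (z n) * Re w * A\<^sup>2 \<le> Re (\<psi> (z n)) * Re (\<psi> w) * (norm (z n + cnj w))\<^sup>2"
        unfolding A_def by (rule Schwarz_Pick_half_plane_nonneg[OF hol\<psi> nonneg zpos w(1)])
      \<comment> \<open>\<open>Re (\<psi> (z n))\<close> is bounded by \<open>A\<close> itself, so
        one of the two factors \<open>A\<close> on the left cancels and a linear bound on
        \<open>A\<close> remains.\<close>
      also have "\<dots> \<le> A * (\<delta> * Re w) * (norm (z n + cnj w))\<^sup>2"
      proof (intro mult_right_mono mult_mono \<psi>w)
        have "Re (\<psi> (z n)) \<le> Re (\<psi> (z n) + cnj (\<psi> w))" using nonneg[OF w(1)] by simp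
        also have "\<dots> \<le> A" unfolding A_def by (rule complex_Re_le_cmod)
        finally show "Re (\<psi> (z n)) \<le> A" .
      qed (auto simp: A_def nonneg w)
      finally have "Re w * A * (Re (z n) * A) \<le> Re w * A * (\<delta> * (norm (z n + cnj w))\<^sup>2)"
        by (simp add: power2_eq_square mult_ac)
      then have "Re (z n) * A \<le> \<delta> * (norm (z n + cnj w))\<^sup>2"
        using w(1) \<delta> by (cases "A = 0") (auto simp: A_def)
      then have "(1 + M) * (Re (z n) * A) \<le> (1 + M) * (\<delta> * (norm (z n + cnj w))\<^sup>2)"
        using M0 by (intro mult_left_mono) auto
      moreover have "norm (z n) * A \<le> (1 + M) * Re (z n) * A"
        by (intro mult_right_mono sector) (simp add: A_def)
      ultimately have "norm (z n) * A \<le> \<delta> * (1 + M) * (norm (z n + cnj w))\<^sup>2"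
        by (simp add: mult_ac)
      then have A: "A / norm (z n) \<le> \<delta> * (1 + M) * (norm (z n + cnj w) / norm (z n))\<^sup>2"
        using zn by (simp add: field_simps power2_eq_square)
      have "norm (\<psi> (z n)) \<le> A + norm (\<psi> w)"
        unfolding A_def using norm_triangle_ineq4[of "\<psi> (z n) + cnj (\<psi> w)" "cnj (\<psi> w)"] by simp
      then have "norm (\<psi> (z n)) / norm (z n) \<le> A / norm (z n) + norm (\<psi> w) / norm (z n)"
        using zn by (simp add: add_divide_distrib[symmetric] divide_right_mono)
      then show ?thesis using A by (simp add: norm_divide)
    qed
    \<comment> \<open>The base point \<open>w\<close> stays fixed while \<open>z n\<close> tends to
      infinity, so both terms involving it disappear in the limit.\<close>
    have "(\<lambda>n. \<delta> * (1 + M) * (norm (1 + cnj w / z n))\<^sup>2 + norm (\<psi> w / z n))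
        \<longlonglongrightarrow> \<delta> * (1 + M) * (norm (1 + 0 :: complex))\<^sup>2 + norm (0 :: complex)"
      by (intro tendsto_intros tendsto_divide_0[OF tendsto_const] norm_inf)
    moreover have "\<delta> * (1 + M) = r / 4" using M0 by (simp add: \<delta>_def field_simps)
    then have "\<delta> * (1 + M) * (norm (1 + 0 :: complex))\<^sup>2 + norm (0 :: complex) < r"
      using r by simp
    ultimately have "\<forall>\<^sub>F n in sequentially. \<delta> * (1 + M) * (norm (1 + cnj w / z n))\<^sup>2 + norm (\<psi> w / z n) < r"
      by (rule order_tendstoD(2))
    then have "\<forall>\<^sub>F n in sequentially. norm (\<psi> (z n) / z n - 0) < r"
    proof eventually_elim
      case (elim n)
      have "z n \<noteq> 0" using zpos[of n] by auto
      then have "norm (z n + cnj w) / norm (z n) = norm (1 + cnj w / z n)"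
        by (simp add: norm_divide[symmetric] add_divide_distrib)
      then show ?case using est[of n] elim by (simp add: norm_divide)
    qed
    then show "\<exists>no. \<forall>n\<ge>no. norm (\<psi> (z n) / z n - 0) < r"
      by (simp add: eventually_sequentially)
  qed
  then have "(\<lambda>n. \<psi> (z n) / z n + of_real c) \<longlonglongrightarrow> 0 + of_real c"
    by (intro tendsto_intros)
  moreover have "\<psi> (z n) / z n + of_real c = \<phi> (z n) / z n" for n
    using zpos[of n] by (auto simp: \<psi>_def diff_divide_distrib)
  ultimately show ?thesis by simp
qed

text \<open>Positivity of \<open>c\<close> is used twice: it forces the images to infinity through
  their real parts, and it allows the limit \<open>c\<close> of the quotients
  \<open>\<phi> z / z\<close> to be inverted.\<close>

lemma Inf_imp_angular_deriv_at_infinity: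
  assumes hol: "\<phi> holomorphic_on right_half_plane" and c: "0 < c"
    and le: "\<And>z. 0 < Re z \<Longrightarrow> c * Re z \<le> Re (\<phi> z)"
    and inf: "\<And>e. c < e \<Longrightarrow> \<exists>w. 0 < Re w \<and> Re (\<phi> w) < e * Re w"
  shows "has_angular_deriv_at_infinity \<phi> (of_real (1 / c))"
  unfolding has_angular_deriv_at_infinity_def fixes_infinity_def
proof (intro conjI allI impI)
  fix z assume nt: "nontangential_to_infinity z"
  then have zpos: "0 < Re (z n)" and lim: "filterlim (\<lambda>n. Re (z n)) at_top sequentially" for n
    unfolding nontangential_to_infinity_def by auto
  have "filterlim (\<lambda>n. c * Re (z n)) at_top sequentially"
    by (rule filterlim_tendsto_pos_mult_at_top[OF tendsto_const c lim])
  then have "filterlim (\<lambda>n. norm (\<phi> (z n))) at_top sequentially"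
    by (rule filterlim_at_top_mono)
       (auto intro!: always_eventually intro: order_trans[OF le[OF zpos] complex_Re_le_cmod])
  then show "filterlim (\<lambda>n. \<phi> (z n)) at_infinity sequentially"
    by (simp add: filterlim_at_infinity_conv_norm_at_top)
  have "(\<lambda>n. inverse (\<phi> (z n) / z n)) \<longlonglongrightarrow> inverse (of_real c)"
    using Julia_Caratheodory_infinity[OF hol le inf nt] c by (intro tendsto_inverse) auto
  then show "(\<lambda>n. z n / \<phi> (z n)) \<longlonglongrightarrow> of_real (1 / c)"
    by (simp add: inverse_eq_divide)
qed

section \<open>Boundedness and the norm\<close>

theorem corollary3p5:
  fixes p :: real and \<phi> :: "complex \<Rightarrow> complex"
  assumes "0 < p"
    and "\<phi> holomorphic_on right_half_plane"
    and "\<phi> ` right_half_plane \<subseteq> right_half_plane"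
  shows "(comp_op_bounded p \<phi> \<longleftrightarrow> comp_op_bounded 2 \<phi>) \<and>
    (comp_op_bounded p \<phi> \<longrightarrow>
      fixes_infinity \<phi> \<and>
      (\<exists>\<Lambda>::real. 0 < \<Lambda> \<and> has_angular_deriv_at_infinity \<phi> (of_real \<Lambda>) \<and>
         comp_op_norm p \<phi> = \<Lambda> powr (1 / p)))"
proof -
  \<comment> \<open>The best constant in \<open>c * Re z \<le> Re (\<phi> z)\<close>, defined
    without reference to the exponent.\<close>
  define c where "c = (INF z\<in>right_half_plane. Re (\<phi> z) / Re z)"
  have pos: "0 < Re (\<phi> z)" if "0 < Re z" for z using assms(3) that by (simp add: image_subset_iff)
  have ne: "right_half_plane \<noteq> {}" using mem_right_half_plane[of 1] by (metis empty_iff one_complex.sel(1) zero_less_one)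
  have bdd: "bdd_below ((\<lambda>z. Re (\<phi> z) / Re z) ` right_half_plane)"
    using pos by (auto intro!: bdd_belowI2[of _ 0] simp: less_imp_le)
  have le: "c * Re z \<le> Re (\<phi> z)" if "0 < Re z" for z
  proof -
    have "c \<le> Re (\<phi> z) / Re z" unfolding c_def using that by (intro cINF_lower bdd) auto
    then show ?thesis using that by (simp add: pos_le_divide_eq)
  qed
  have inf: "\<exists>w. 0 < Re w \<and> Re (\<phi> w) < e * Re w" if e: "c < e" for e
  proof -
    obtain w where "w \<in> right_half_plane" "Re (\<phi> w) / Re w < e"
      using e unfolding c_def cINF_less_iff[OF ne bdd] by blast
    then show ?thesis by (auto simp: pos_divide_less_eq)
  qed
  have lower: "0 < comp_op_norm q \<phi> \<and> 1 / comp_op_norm q \<phi> powr q \<le> c"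
    if q: "0 < q" and b: "comp_op_bounded q \<phi>" for q
  proof -
    let ?N = "comp_op_norm q \<phi>"
    note N = comp_op_bounded_Re_le[OF q assms(3) b]
    \<comment> \<open>With norm 0 the comparison at the point 1 would read \<open>1 \<le> 0\<close>,
      because \<open>0 powr q = 0\<close>.\<close>
    have "?N \<noteq> 0" using N(1)[of 1] q by auto
    then have N0: "0 < ?N" using N(2)[of 1] by simp
    have "1 / ?N powr q \<le> c"
      unfolding c_def using N(1) N0 by (intro cINF_greatest ne) (simp add: field_simps)
    then show ?thesis using N0 by simp
  qed
  have cpos: "0 < c" if "0 < q" "comp_op_bounded q \<phi>" for q
  proof -
    have "0 < 1 / comp_op_norm q \<phi> powr q" using lower[OF that] by simp
    then show ?thesis using lower[OF that] by linarith
  qed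
  \<comment> \<open>The criterion is the same for every exponent, so boundedness for
    \<open>p\<close> and for 2 are equivalent.\<close>
  have iff: "comp_op_bounded q \<phi> \<longleftrightarrow> 0 < c" if "0 < q" for q
    using cpos comp_op_boundedI(1)[OF that assms(2,3) _ le] that by blast
  have "fixes_infinity \<phi> \<and>
      (\<exists>\<Lambda>::real. 0 < \<Lambda> \<and> has_angular_deriv_at_infinity \<phi> (of_real \<Lambda>) \<and> comp_op_norm p \<phi> = \<Lambda> powr (1 / p))"
    if b: "comp_op_bounded p \<phi>"
  proof -
    have c: "0 < c" using iff[OF assms(1)] b by simp
    have ad: "has_angular_deriv_at_infinity \<phi> (of_real (1 / c))"
      by (rule Inf_imp_angular_deriv_at_infinity[OF assms(2) c le inf])
    have N: "0 < comp_op_norm p \<phi>" "1 / comp_op_norm p \<phi> powr p \<le> c"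
      using lower[OF assms(1) b] by auto
    \<comment> \<open>The extremal functions give this lower bound on the norm; it matches the upper
      bound from the Poisson estimate exactly.\<close>
    then have "1 / c \<le> comp_op_norm p \<phi> powr p" using c by (simp add: field_simps)
    then have "(1 / c) powr (1 / p) \<le> (comp_op_norm p \<phi> powr p) powr (1 / p)"
      using c assms(1) by (intro powr_mono2) auto
    then have "(1 / c) powr (1 / p) \<le> comp_op_norm p \<phi>"
      using N(1) assms(1) by (simp add: powr_powr)
    moreover have "comp_op_norm p \<phi> \<le> (1 / c) powr (1 / p)"
      by (rule comp_op_boundedI(2)[OF assms c le])
    ultimately have "comp_op_norm p \<phi> = (1 / c) powr (1 / p)" by simp
    then show ?thesis
      using ad c by (auto simp: has_angular_deriv_at_infinity_def intro!: exI[of _ "1 / c"])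
  qed
  then show ?thesis using iff[OF assms(1)] iff[of 2] by simp
qed

end
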